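(* Suppose that for all $n<\omega$ there is a normal ideal $I$ on $\omega_{n+1}$ such that $\mathcal P(\omega_{n+1})/I\cong\mathcal B(\mathrm{Col}(\omega_n,\omega_{n+1}))$. Then for all $a,b,c\in\omega$ such that $a<b\le c+1$, there is a uniform ultrafilter $\mathcal U$ on $\omega_c$ such that $|\omega_a^{\omega_c}/\mathcal U|=\omega_b$.
   Context: For ordinals $\kappa,\lambda$, $\mathrm{Col}(\kappa,\lambda)$ is the poset of partial functions from $\kappa$ to $\lambda$ defined at fewer than $\kappa$ many points, ordered by reverse inclusion. $\mathcal B(\mathbb P)$ is the Boolean completion of $\mathbb P$. An ultrafilter on $X$ is uniform if all its members have cardinality $|X|$. $\omega_a^{\omega_c}/\mathcal U$ denotes the ultrapower, i.e. the set of equivalence classes of functions $f:\omega_c\to\omega_a$ modulo equality on a set in $\mathcal U$. *)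

theory Defs
  imports Main "HOL-Library.FuncSet"
begin

unbundle cardinal_syntax

text \<open>
  An ordinal is represented by a well-order relation \<open>r\<close>; its elements (the smaller ordinals) are
  the members of \<open>Field r\<close>, and \<open>underS r x\<close> is the set of elements strictly below \<open>x\<close>.

  \<open>omegas om\<close> says that \<open>om n\<close> is a well-order of order type \<open>\<omega>\<^sub>n\<close> for every \<open>n\<close>. No HOL type
  is provably large enough to carry all the \<open>\<omega>\<^sub>n\<close> simultaneously, so such a sequence on an
  arbitrary type \<open>'a\<close> is a parameter rather than a constant. As \<open>=o\<close> is isomorphism of
  well-orders, the sequence is unique up to isomorphism; the sets \<open>Field (om n)\<close> need not be nested.
\<close>

definition omegas :: "(nat \<Rightarrow> 'a rel) \<Rightarrow> bool" where
  "omegas om \<longleftrightarrow> om 0 =o natLeq \<and> (\<forall>n. om (Suc n) =o cardSuc (om n))"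

definition ideal_on :: "'a set \<Rightarrow> 'a set set \<Rightarrow> bool" where
  "ideal_on X I \<longleftrightarrow>
     I \<subseteq> Pow X \<and> {} \<in> I \<and> X \<notin> I \<and>
     (\<forall>A\<in>I. \<forall>B. B \<subseteq> A \<longrightarrow> B \<in> I) \<and>
     (\<forall>A\<in>I. \<forall>B\<in>I. A \<union> B \<in> I)"

definition diagonal_union :: "'a rel \<Rightarrow> ('a \<Rightarrow> 'a set) \<Rightarrow> 'a set" where
  "diagonal_union \<kappa> A = {\<beta> \<in> Field \<kappa>. \<exists>\<xi>\<in>underS \<kappa> \<beta>. \<beta> \<in> A \<xi>}"

text \<open>
  As usual, an ideal on a cardinal \<open>\<kappa>\<close> is required to be proper and to contain the bounded
  subsets of \<open>\<kappa>\<close>. Together with closure under diagonal unions this yields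
  \<open>\<kappa>\<close>-completeness: the union of \<open>A \<xi>\<close> over \<open>\<xi> < \<delta>\<close> is contained in the union of the
  bounded set \<open>\<delta>\<close> and the diagonal union of the (suitably extended) family.
\<close>

definition normal_ideal :: "'a rel \<Rightarrow> 'a set set \<Rightarrow> bool" where
  "normal_ideal \<kappa> I \<longleftrightarrow>
     ideal_on (Field \<kappa>) I \<and>
     (\<forall>\<beta>\<in>Field \<kappa>. underS \<kappa> \<beta> \<in> I) \<and>
     (\<forall>A. (\<forall>\<xi>\<in>Field \<kappa>. A \<xi> \<in> I) \<longrightarrow> diagonal_union \<kappa> A \<in> I)"

record 'b balg =
  carr :: "'b set"
  meet :: "'b \<Rightarrow> 'b \<Rightarrow> 'b"
  join :: "'b \<Rightarrow> 'b \<Rightarrow> 'b"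
  compl :: "'b \<Rightarrow> 'b"
  bzero :: 'b
  bone :: 'b

definition balg_isomorphic :: "'b balg \<Rightarrow> 'c balg \<Rightarrow> bool" where
  "balg_isomorphic B C \<longleftrightarrow>
     (\<exists>\<phi>. bij_betw \<phi> (carr B) (carr C) \<and>
        (\<forall>x\<in>carr B. \<forall>y\<in>carr B. \<phi> (meet B x y) = meet C (\<phi> x) (\<phi> y)) \<and>
        (\<forall>x\<in>carr B. \<forall>y\<in>carr B. \<phi> (join B x y) = join C (\<phi> x) (\<phi> y)) \<and>
        (\<forall>x\<in>carr B. \<phi> (compl B x) = compl C (\<phi> x)) \<and>
        \<phi> (bzero B) = bzero C \<and> \<phi> (bone B) = bone C)"

definition mod_ideal :: "'a set \<Rightarrow> 'a set set \<Rightarrow> 'a set rel" where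
  "mod_ideal X I = {(A, B). A \<subseteq> X \<and> B \<subseteq> X \<and> (A - B) \<union> (B - A) \<in> I}"

text \<open>
  The quotient algebra of \<open>Pow X\<close> by \<open>I\<close>. The unions over representatives collapse, because the
  operations respect \<open>mod_ideal X I\<close>; see \<open>quotient_algebra_simps\<close> below.
\<close>

definition quotient_algebra :: "'a set \<Rightarrow> 'a set set \<Rightarrow> 'a set set balg" where
  "quotient_algebra X I =
     \<lparr> carr = Pow X // mod_ideal X I,
       meet = (\<lambda>S T. \<Union>A\<in>S. \<Union>B\<in>T. mod_ideal X I `` {A \<inter> B}),
       join = (\<lambda>S T. \<Union>A\<in>S. \<Union>B\<in>T. mod_ideal X I `` {A \<union> B}),
       compl = (\<lambda>S. \<Union>A\<in>S. mod_ideal X I `` {X - A}),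
       bzero = mod_ideal X I `` {{}},
       bone = mod_ideal X I `` {X} \<rparr>"

lemma equiv_mod_ideal:
  assumes "ideal_on X I"
  shows "equiv (Pow X) (mod_ideal X I)"
proof (rule equivI)
  have sub: "\<And>A B. A \<in> I \<Longrightarrow> B \<subseteq> A \<Longrightarrow> B \<in> I" and un: "\<And>A B. A \<in> I \<Longrightarrow> B \<in> I \<Longrightarrow> A \<union> B \<in> I"
    using assms by (auto simp: ideal_on_def)
  show "mod_ideal X I \<subseteq> Pow X \<times> Pow X"
    by (auto simp: mod_ideal_def)
  show "refl_on (Pow X) (mod_ideal X I)"
    using assms by (auto simp: refl_on_def mod_ideal_def ideal_on_def)
  show "sym (mod_ideal X I)"
    by (auto simp: sym_def mod_ideal_def Un_commute)
  show "trans (mod_ideal X I)"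
  proof (rule transI)
    fix A B C assume "(A, B) \<in> mod_ideal X I" "(B, C) \<in> mod_ideal X I"
    then show "(A, C) \<in> mod_ideal X I"
      using sub[OF un[of "(A - B) \<union> (B - A)" "(B - C) \<union> (C - B)"], of "(A - C) \<union> (C - A)"]
      by (auto simp: mod_ideal_def)
  qed
qed

lemma quotient_algebra_simps:
  assumes I: "ideal_on X I" and A: "A \<subseteq> X" and B: "B \<subseteq> X"
  shows "meet (quotient_algebra X I) (mod_ideal X I `` {A}) (mod_ideal X I `` {B})
           = mod_ideal X I `` {A \<inter> B}"
    and "join (quotient_algebra X I) (mod_ideal X I `` {A}) (mod_ideal X I `` {B})
           = mod_ideal X I `` {A \<union> B}"
    and "compl (quotient_algebra X I) (mod_ideal X I `` {A}) = mod_ideal X I `` {X - A}"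
proof -
  note eq = equiv_mod_ideal[OF I]
  have sub: "\<And>A B. A \<in> I \<Longrightarrow> B \<subseteq> A \<Longrightarrow> B \<in> I" and un: "\<And>A B. A \<in> I \<Longrightarrow> B \<in> I \<Longrightarrow> A \<union> B \<in> I"
    using I by (auto simp: ideal_on_def)
  have both: "(A - A') \<union> (A' - A) \<union> ((B - B') \<union> (B' - B)) \<in> I"
    if "(A, A') \<in> mod_ideal X I" "(B, B') \<in> mod_ideal X I" for A A' B B'
    using that un by (auto simp: mod_ideal_def)
  have "congruent2 (mod_ideal X I) (mod_ideal X I) (\<lambda>A B. mod_ideal X I `` {A \<inter> B})"
  proof (rule congruent2I')
    fix A A' B B' assume h: "(A, A') \<in> mod_ideal X I" "(B, B') \<in> mod_ideal X I"
    have "(A \<inter> B, A' \<inter> B') \<in> mod_ideal X I"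
      using h sub[OF both[OF h], of "(A \<inter> B - A' \<inter> B') \<union> (A' \<inter> B' - A \<inter> B)"]
      by (auto simp: mod_ideal_def)
    then show "mod_ideal X I `` {A \<inter> B} = mod_ideal X I `` {A' \<inter> B'}"
      by (rule equiv_class_eq[OF eq])
  qed
  from UN_equiv_class2[OF eq eq this, of A B] A B
  show "meet (quotient_algebra X I) (mod_ideal X I `` {A}) (mod_ideal X I `` {B})
           = mod_ideal X I `` {A \<inter> B}"
    by (simp add: quotient_algebra_def)
  have "congruent2 (mod_ideal X I) (mod_ideal X I) (\<lambda>A B. mod_ideal X I `` {A \<union> B})"
  proof (rule congruent2I')
    fix A A' B B' assume h: "(A, A') \<in> mod_ideal X I" "(B, B') \<in> mod_ideal X I"
    have "(A \<union> B, A' \<union> B') \<in> mod_ideal X I"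
      using h sub[OF both[OF h], of "(A \<union> B - (A' \<union> B')) \<union> (A' \<union> B' - (A \<union> B))"]
      by (auto simp: mod_ideal_def)
    then show "mod_ideal X I `` {A \<union> B} = mod_ideal X I `` {A' \<union> B'}"
      by (rule equiv_class_eq[OF eq])
  qed
  from UN_equiv_class2[OF eq eq this, of A B] A B
  show "join (quotient_algebra X I) (mod_ideal X I `` {A}) (mod_ideal X I `` {B})
           = mod_ideal X I `` {A \<union> B}"
    by (simp add: quotient_algebra_def)
  have "congruent (mod_ideal X I) (\<lambda>A. mod_ideal X I `` {X - A})"
  proof (rule congruentI)
    fix A A' assume h: "(A, A') \<in> mod_ideal X I"
    have "(X - A, X - A') \<in> mod_ideal X I"
      using h sub[of "(A - A') \<union> (A' - A)" "(X - A - (X - A')) \<union> (X - A' - (X - A))"]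
      by (auto simp: mod_ideal_def)
    then show "mod_ideal X I `` {X - A} = mod_ideal X I `` {X - A'}"
      by (rule equiv_class_eq[OF eq])
  qed
  from UN_equiv_class[OF eq this, of A] A
  show "compl (quotient_algebra X I) (mod_ideal X I `` {A}) = mod_ideal X I `` {X - A}"
    by (simp add: quotient_algebra_def)
qed

text \<open>
  Boolean completion of a poset \<open>P\<close> with order \<open>le\<close>: the regular open sets of the topology on
  \<open>P\<close> whose open sets are the downward closed ones. In this topology the closure of \<open>U\<close> is
  \<open>{p \<in> P. \<exists>r\<in>P. le r p \<and> r \<in> U}\<close>, the interior of \<open>U\<close> is
  \<open>{p \<in> P. \<forall>q\<in>P. le q p \<longrightarrow> q \<in> U}\<close>, and \<open>int_cl P le U\<close> is the interior of the closure.
\<close>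

definition int_cl :: "'p set \<Rightarrow> ('p \<Rightarrow> 'p \<Rightarrow> bool) \<Rightarrow> 'p set \<Rightarrow> 'p set" where
  "int_cl P le U = {p \<in> P. \<forall>q\<in>P. le q p \<longrightarrow> (\<exists>r\<in>P. le r q \<and> r \<in> U)}"

definition boolean_completion :: "'p set \<Rightarrow> ('p \<Rightarrow> 'p \<Rightarrow> bool) \<Rightarrow> 'p set balg" where
  "boolean_completion P le =
     \<lparr> carr = {U. U \<subseteq> P \<and> int_cl P le U = U},
       meet = (\<inter>),
       join = (\<lambda>U V. int_cl P le (U \<union> V)),
       compl = (\<lambda>U. {p \<in> P. \<forall>q\<in>P. le q p \<longrightarrow> q \<notin> U}),
       bzero = {},
       bone = P \<rparr>"

text \<open>
  \<open><o\<close> compares the cardinal of the domain with \<open>\<kappa>\<close> as well-orders, so \<open>Col \<kappa> \<mu>\<close> makes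
  sense for arbitrary ordinals.
\<close>

definition Col :: "'a rel \<Rightarrow> 'b rel \<Rightarrow> ('a \<rightharpoonup> 'b) set" where
  "Col \<kappa> \<mu> = {p. dom p \<subseteq> Field \<kappa> \<and> ran p \<subseteq> Field \<mu> \<and> |dom p| <o \<kappa>}"

definition rev_incl :: "('a \<rightharpoonup> 'b) \<Rightarrow> ('a \<rightharpoonup> 'b) \<Rightarrow> bool" where
  "rev_incl p q \<longleftrightarrow> q \<subseteq>\<^sub>m p"

definition ultrafilter_on :: "'a set \<Rightarrow> 'a set set \<Rightarrow> bool" where
  "ultrafilter_on X U \<longleftrightarrow>
     U \<subseteq> Pow X \<and> X \<in> U \<and> {} \<notin> U \<and>
     (\<forall>A\<in>U. \<forall>B. A \<subseteq> B \<and> B \<subseteq> X \<longrightarrow> B \<in> U) \<and>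
     (\<forall>A\<in>U. \<forall>B\<in>U. A \<inter> B \<in> U) \<and>
     (\<forall>A. A \<subseteq> X \<longrightarrow> A \<in> U \<or> X - A \<in> U)"

definition uniform_ultrafilter_on :: "'a set \<Rightarrow> 'a set set \<Rightarrow> bool" where
  "uniform_ultrafilter_on X U \<longleftrightarrow> ultrafilter_on X U \<and> (\<forall>A\<in>U. |A| =o |X| )"

definition ultrapower :: "'b set \<Rightarrow> 'a set \<Rightarrow> 'a set set \<Rightarrow> ('a \<Rightarrow> 'b) set set" where
  "ultrapower Y X U =
     (X \<rightarrow>\<^sub>E Y) // {(f, g). f \<in> X \<rightarrow>\<^sub>E Y \<and> g \<in> X \<rightarrow>\<^sub>E Y \<and> {x \<in> X. f x = g x} \<in> U}"

end

theory Submission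
  imports Defs
begin

text \<open>
  Let \<open>P n\<close> be the collapse of \<open>\<omega>\<^sub>n\<^sub>+\<^sub>1\<close> to \<open>\<omega>\<^sub>n\<close>. The isomorphism of algebras says that \<open>P n\<close> is
  densely embedded in the quotient of the power set of \<open>\<omega>\<^sub>n\<^sub>+\<^sub>1\<close> by the ideal \<open>I n\<close>
  (\<open>dense_system\<close>); a condition \<open>p\<close> is represented by a positive set \<open>X n p\<close>. All arguments about
  generic ultrapowers can be carried out in terms of these sets.

  The instance \<open>2\<^bsup>\<omega>\<^sub>n\<^esup> = \<omega>\<^sub>n\<^sub>+\<^sub>1\<close> of the continuum hypothesis follows from the ideal on \<open>\<omega>\<^sub>n\<^sub>+\<^sub>2\<close>,
  because a descending sequence of conditions of length \<open>\<omega>\<^sub>n\<close> can decide a subset of \<open>\<omega>\<^sub>n\<close>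
  completely (\<open>Pow_K_ordLeq\<close>).

  The size \<open>\<omega>\<^sub>b\<close> is reached by a product of two ultrafilters, one of them regular on \<open>\<omega>\<^sub>b\<^sub>-\<^sub>1\<close> and the
  other one, \<open>U\<close>, on \<open>\<omega>\<^sub>c\<close> (\<open>regular_product\<close>). The regular one makes the ultrapower of \<open>\<omega>\<^sub>a\<close> at
  least as large as \<open>2\<^bsup>\<omega>\<^sub>b\<^sub>-\<^sub>1\<^esup>\<close>, and the ultrapower by the product is an iterated one, so that it is
  not larger than \<open>\<omega>\<^sub>b\<close> if the ultrapower by \<open>U\<close> is not. This leaves the problem of finding, for
  \<open>a < c\<close>, a uniform ultrafilter \<open>U\<close> on \<open>\<omega>\<^sub>c\<close> such that the ultrapower of \<open>\<omega>\<^sub>a\<close> has only \<open>\<omega>\<^sub>a\<^sub>+\<^sub>1\<close>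
  elements (\<open>small_ultrapower\<close>). It will extend the filter dual to the ideal on \<open>\<omega>\<^sub>c\<close>.

  For \<open>c = a + 1\<close>, a function from \<open>\<omega>\<^sub>c\<close> to \<open>\<omega>\<^sub>a\<close> is decided by the members of a maximal antichain of
  \<open>P a\<close>, which may have \<open>\<omega>\<^sub>a\<^sub>+\<^sub>1\<close> members. But \<open>\<omega>\<^sub>a\<close> many of them that are closed off suitably have a
  supremum that can be put into \<open>U\<close>, for all functions at the same time. Then a function is
  determined modulo \<open>U\<close> by \<open>\<omega>\<^sub>a\<close> many conditions and values (\<open>small_ultrapower_base\<close>).

  The step from \<open>\<omega>\<^sub>c\<close> to \<open>\<omega>\<^sub>c\<^sub>+\<^sub>1\<close> uses sequences \<open>q\<close> of conditions in \<open>P c\<close> that are indexed by \<open>\<omega>\<^sub>c\<close>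
  and ordered modulo the ideal on \<open>\<omega>\<^sub>c\<close>. Suppose that \<open>G\<close> is a chain of such sequences and that
  every dense subset of \<open>P c\<close> contains all members of some \<open>q\<close> in \<open>G\<close>. Then the subsets of
  \<open>\<omega>\<^sub>c\<^sub>+\<^sub>1\<close> that contain \<open>X c (q x)\<close> almost everywhere, for some \<open>q\<close> in \<open>G\<close> and \<open>U\<close>-almost all \<open>x\<close>, form an
  ultrafilter, and a function on \<open>\<omega>\<^sub>c\<^sub>+\<^sub>1\<close> is reduced to the function on \<open>\<omega>\<^sub>c\<close> that maps \<open>x\<close> to the value
  decided by \<open>q x\<close>. So the ultrapower does not grow (\<open>small_ultrapower_step\<close>).

  The chain has to meet \<open>\<omega>\<^sub>c\<^sub>+\<^sub>2\<close> many dense sets, although descending sequences of length \<open>\<omega>\<^sub>c\<^sub>+\<^sub>1\<close>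
  need not have lower bounds; these sets cannot be enumerated and met one after the other. Here the
  ideal on \<open>\<omega>\<^sub>c\<^sub>+\<^sub>2\<close> helps (\<open>generic_chain\<close>). A generic collapse of \<open>\<omega>\<^sub>c\<^sub>+\<^sub>2\<close> codes a sequence of length
  \<open>\<omega>\<^sub>c\<^sub>+\<^sub>1\<close>, from which a chain can be read off. For each dense set of the generic ultrapower, a
  density argument shows that this chain meets it; as in the proof that such a collapse adds a
  diamond sequence, initial parts of the dense set are decided along with the chain, until a member
  of the chain can be chosen inside it. By elementarity there is such a chain in the ground model.
\<close>

section \<open>The cardinals \<open>\<omega>\<^sub>n\<close>\<close>

lemma ordLeq_ordLess_False: "r \<le>o s \<Longrightarrow> s <o r \<Longrightarrow> False"
  using not_ordLess_ordLeq by blast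

lemma card_of_quotient_ordLeq: "|A // r| \<le>o |A|"
proof -
  have "A // r = (\<lambda>a. r `` {a}) ` A"
    by (auto simp: quotient_def)
  then show ?thesis
    using card_of_image by metis
qed

lemma card_of_PiE_mono:
  assumes "|A| \<le>o |B|"
  shows "|X \<rightarrow>\<^sub>E A| \<le>o |X \<rightarrow>\<^sub>E B|"
proof -
  obtain g where g: "inj_on g A" "g ` A \<subseteq> B"
    using assms card_of_ordLeq by metis
  let ?G = "\<lambda>f. restrict (g \<circ> f) X"
  have "inj_on ?G (X \<rightarrow>\<^sub>E A)"
  proof (rule inj_onI)
    fix f f' assume f: "f \<in> X \<rightarrow>\<^sub>E A" "f' \<in> X \<rightarrow>\<^sub>E A" and eq: "?G f = ?G f'"
    have "f x = f' x" if "x \<in> X" for x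
      using fun_cong[OF eq, of x] that f g(1) by (auto simp: inj_on_def PiE_iff)
    then show "f = f'"
      using PiE_ext[OF f] by blast
  qed
  moreover have "?G ` (X \<rightarrow>\<^sub>E A) \<subseteq> X \<rightarrow>\<^sub>E B"
    using g(2) by (fastforce simp: PiE_iff)
  ultimately show ?thesis
    using card_of_ordLeq by blast
qed

lemma card_of_PiE_Pow_ordLeq:
  assumes inf: "infinite X" and A: "|A| \<le>o |Pow X|"
  shows "|X \<rightarrow>\<^sub>E A| \<le>o |Pow X|"
proof -
  obtain h where h: "bij_betw h (X \<times> X) X"
    using card_of_Times_same_infinite[OF inf] card_of_ordIso by metis
  \<comment> \<open>A function into the power set is determined by its graph, a subset of the square of \<open>X\<close>.\<close>
  let ?G = "\<lambda>f. h ` {(x, y). x \<in> X \<and> y \<in> f x}"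
  have "inj_on ?G (X \<rightarrow>\<^sub>E Pow X)"
  proof (rule inj_onI)
    fix f f' assume f: "f \<in> X \<rightarrow>\<^sub>E Pow X" "f' \<in> X \<rightarrow>\<^sub>E Pow X" and eq: "?G f = ?G f'"
    have sub: "{(x, y). x \<in> X \<and> y \<in> f x} \<subseteq> X \<times> X" "{(x, y). x \<in> X \<and> y \<in> f' x} \<subseteq> X \<times> X"
      using f by auto
    have "{(x, y). x \<in> X \<and> y \<in> f x} = {(x, y). x \<in> X \<and> y \<in> f' x}"
      using inj_on_image_eq_iff[OF bij_betw_imp_inj_on[OF h] sub] eq by blast
    then have "f x = f' x" if "x \<in> X" for x
      using that by (auto simp: set_eq_iff)
    then show "f = f'"
      using PiE_ext[OF f] by blast
  qed
  moreover have "?G ` (X \<rightarrow>\<^sub>E Pow X) \<subseteq> Pow X"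
  proof -
    have *: "h ` S \<subseteq> X" if "S \<subseteq> X \<times> X" for S
      using that bij_betw_imp_surj_on[OF h] by blast
    then have "?G f \<in> Pow X" if "f \<in> X \<rightarrow>\<^sub>E Pow X" for f
    proof -
      have "{(x, y). x \<in> X \<and> y \<in> f x} \<subseteq> X \<times> X"
        using that by auto
      then show ?thesis
        using * by blast
    qed
    then show ?thesis
      by blast
  qed
  ultimately have "|X \<rightarrow>\<^sub>E Pow X| \<le>o |Pow X|"
    using card_of_ordLeq by blast
  then show ?thesis
    using card_of_PiE_mono[OF A, of X] ordLeq_transitive by blast
qed

locale omega_sequence =
  fixes om :: "nat \<Rightarrow> 'a rel"
  assumes omegas: "omegas om"
begin

abbreviation K :: "nat \<Rightarrow> 'a set" where
  "K n \<equiv> Field (om n)"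

lemma om_zero: "om 0 =o natLeq" and om_Suc: "om (Suc n) =o cardSuc (om n)"
  using omegas by (auto simp: omegas_def)

lemma Card_order_om: "Card_order (om n)"
proof (induction n)
  case 0
  then show ?case
    using Card_order_ordIso[OF natLeq_Card_order om_zero] .
next
  case (Suc n)
  then show ?case
    using Card_order_ordIso[OF cardSuc_Card_order om_Suc] by blast
qed

lemma Well_order_om: "Well_order (om n)"
  using Card_order_om card_order_on_well_order_on by blast

lemma card_of_K: "|K n| =o om n"
  by (rule card_of_Field_ordIso[OF Card_order_om])

lemma K_ordLess_Suc: "|K n| <o |K (Suc n)|"
proof -
  have "om n <o om (Suc n)"
    using ordLess_ordIso_trans[OF cardSuc_greater[OF Card_order_om] ordIso_symmetric[OF om_Suc]] .
  then show ?thesis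
    using ordIso_ordLess_trans[OF card_of_K] ordLess_ordIso_trans ordIso_symmetric[OF card_of_K]
    by blast
qed

lemma K_mono: "m \<le> n \<Longrightarrow> |K m| \<le>o |K n|"
proof (induction rule: dec_induct)
  case base
  show ?case
    by (rule card_of_mono1) simp
next
  case (step n)
  then show ?case
    using K_ordLess_Suc ordLeq_transitive ordLess_imp_ordLeq by blast
qed

lemma infinite_K: "infinite (K n)"
proof -
  have "|K 0| =o natLeq"
    using ordIso_transitive[OF card_of_K om_zero] .
  then have "natLeq \<le>o |K 0|"
    using ordIso_iff_ordLeq by blast
  then have "infinite (K 0)"
    using infinite_iff_natLeq_ordLeq by blast
  then show ?thesis
    using card_of_ordLeq_infinite[OF K_mono[of 0 n]] by simp
qed

lemma ordLess_K_Suc_iff: "|A| <o |K (Suc n)| \<longleftrightarrow> |A| \<le>o |K n|"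
proof -
  have e: "|K (Suc n)| =o cardSuc (om n)"
    using ordIso_transitive[OF card_of_K om_Suc] .
  have "|A| <o |K (Suc n)| \<longleftrightarrow> |A| <o cardSuc (om n)"
    using ordLess_ordIso_trans[OF _ e] ordLess_ordIso_trans[OF _ ordIso_symmetric[OF e]] by blast
  also have "\<dots> \<longleftrightarrow> |A| \<le>o om n"
    using cardSuc_ordLeq_ordLess[OF Card_order_om card_of_Card_order] by blast
  also have "\<dots> \<longleftrightarrow> |A| \<le>o |K n|"
    using ordIso_symmetric[OF card_of_K] card_of_K ordLeq_ordIso_trans by blast
  finally show ?thesis .
qed

lemma ordLess_om_iff: "|A| <o om n \<longleftrightarrow> |A| <o |K n|"
  using ordIso_symmetric[OF card_of_K] card_of_K ordLess_ordIso_trans by blast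

lemma ordLess_om_Suc_iff: "|A| <o om (Suc n) \<longleftrightarrow> |A| \<le>o |K n|"
  using ordLess_om_iff ordLess_K_Suc_iff by blast

lemma not_K_Suc_ordLeq: "\<not> |K (Suc n)| \<le>o |K n|"
  using K_ordLess_Suc not_ordLess_ordLeq by blast

lemma finite_ordLess_K: "finite A \<Longrightarrow> |A| <o |K n|"
  using finite_ordLess_infinite[OF card_of_Well_order card_of_Well_order] infinite_K
  by (metis Field_card_of)

lemma finite_ordLeq_K: "finite A \<Longrightarrow> |A| \<le>o |K n|"
  by (rule ordLess_imp_ordLeq[OF finite_ordLess_K])

lemma K_Suc_ordLeq_Pow: "|K (Suc n)| \<le>o |Pow (K n)|"
proof (rule ccontr)
  assume "\<not> ?thesis"
  then have "|Pow (K n)| <o |K (Suc n)|"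
    using ordLess_or_ordLeq[OF card_of_Well_order card_of_Well_order] by blast
  then have "|Pow (K n)| \<le>o |K n|"
    using ordLess_K_Suc_iff by blast
  then show False
    using card_of_Pow ordLeq_ordLess_False by blast
qed

lemma UN_ordLeq_K:
  assumes "|I| \<le>o |K n|" and "\<And>i. i \<in> I \<Longrightarrow> |A i| \<le>o |K n|"
  shows "|\<Union>i\<in>I. A i| \<le>o |K n|"
  using card_of_UNION_ordLeq_infinite[OF infinite_K] assms by blast

lemma Un_ordLeq_K:
  assumes "|A| \<le>o |K n|" and "|B| \<le>o |K n|"
  shows "|A \<union> B| \<le>o |K n|"
proof -
  have "A \<union> B = (\<Union>X\<in>{A, B}. X)" by auto
  moreover have "|{A, B}| \<le>o |K n|"
    by (rule finite_ordLeq_K) simp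
  ultimately show ?thesis
    using UN_ordLeq_K[of "{A, B}" n "\<lambda>X. X"] assms by auto
qed

lemma image_ordLeq_K: "|A| \<le>o |K n| \<Longrightarrow> |f ` A| \<le>o |K n|"
  using card_of_image ordLeq_transitive by blast

lemma subset_ordLeq_K: "A \<subseteq> B \<Longrightarrow> |B| \<le>o |K n| \<Longrightarrow> |A| \<le>o |K n|"
  using card_of_mono1 ordLeq_transitive by blast

lemma PiE_K_ordLeq_Pow:
  assumes "|A| \<le>o |Pow (K n)|"
  shows "|K n \<rightarrow>\<^sub>E A| \<le>o |Pow (K n)|"
  by (rule card_of_PiE_Pow_ordLeq[OF infinite_K assms])

abbreviation below :: "nat \<Rightarrow> 'a \<Rightarrow> 'a set" where
  "below n x \<equiv> underS (om n) x"

lemma wf_om: "wf (om n - Id)"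
  using Well_order_om well_order_on_def by metis

lemma below_iff: "y \<in> below n x \<longleftrightarrow> (y, x) \<in> om n - Id"
  by (auto simp: underS_def)

lemma below_subset: "below n x \<subseteq> K n"
  by (auto simp: underS_def Field_def)

lemma below_trans: "x \<in> below n y \<Longrightarrow> y \<in> below n z \<Longrightarrow> x \<in> below n z"
  using Well_order_om[of n] unfolding underS_def order_on_defs trans_def antisym_def by blast

lemma below_irrefl: "x \<notin> below n x"
  by (auto simp: underS_def)

lemma below_linear: "x \<in> K n \<Longrightarrow> y \<in> K n \<Longrightarrow> x \<in> below n y \<or> x = y \<or> y \<in> below n x"
  using Well_order_om[of n] unfolding underS_def order_on_defs total_on_def by blast

lemma ex_above: "x \<in> K n \<Longrightarrow> \<exists>y\<in>K n. x \<in> below n y"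
  using infinite_Card_order_limit[OF Card_order_om infinite_K] by (auto simp: underS_def Field_def)

lemma below_Suc_ordLeq: "x \<in> K (Suc n) \<Longrightarrow> |below (Suc n) x| \<le>o |K n|"
  using card_of_underS[OF Card_order_om] ordLess_om_Suc_iff by blast

text \<open>This is the regularity of successor cardinals.\<close>

lemma ex_bound:
  assumes A: "A \<subseteq> K (Suc n)" and small: "|A| \<le>o |K n|"
  shows "\<exists>y\<in>K (Suc n). A \<subseteq> below (Suc n) y"
proof (rule ccontr)
  assume *: "\<not> ?thesis"
  have "K (Suc n) \<subseteq> (\<Union>a\<in>A. below (Suc n) a \<union> {a})"
  proof
    fix y assume y: "y \<in> K (Suc n)"
    then obtain a where "a \<in> A" "a \<notin> below (Suc n) y"
      using * by auto
    then show "y \<in> (\<Union>a\<in>A. below (Suc n) a \<union> {a})"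
      using below_linear[OF y, of a] A by auto
  qed
  moreover have "|\<Union>a\<in>A. below (Suc n) a \<union> {a}| \<le>o |K n|"
    using A by (intro UN_ordLeq_K[OF small] Un_ordLeq_K below_Suc_ordLeq finite_ordLeq_K) auto
  ultimately show False
    using subset_ordLeq_K not_K_Suc_ordLeq by blast
qed

end

section \<open>Ideals whose quotient has a dense copy of a poset\<close>

text \<open>
  Up to the ideal \<open>I\<close>, the map \<open>X\<close> is a dense embedding of \<open>P\<close> in the positive subsets of \<open>S\<close>.
\<close>

definition dense_system ::
    "'x set \<Rightarrow> 'x set set \<Rightarrow> 'p set \<Rightarrow> ('p \<Rightarrow> 'p \<Rightarrow> bool) \<Rightarrow> ('p \<Rightarrow> 'x set) \<Rightarrow> bool" where
  "dense_system S I P le X \<longleftrightarrow>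
     (\<forall>p\<in>P. X p \<subseteq> S \<and> X p \<notin> I) \<and>
     (\<forall>p\<in>P. \<forall>q\<in>P. le p q \<longrightarrow> X p - X q \<in> I) \<and>
     (\<forall>p\<in>P. \<forall>q\<in>P. X p \<inter> X q \<notin> I \<longrightarrow> (\<exists>r\<in>P. le r p \<and> le r q)) \<and>
     (\<forall>A. A \<subseteq> S \<and> A \<notin> I \<longrightarrow> (\<exists>p\<in>P. X p - A \<in> I))"

text \<open>
  A condition is represented by a set whose class corresponds to the regular open set generated by
  the condition. An isomorphism preserves the order and disjointness, and each nonempty regular open
  set contains one that is generated by a condition.
\<close>

lemma dense_system_if_balg_isomorphic:
  assumes I: "ideal_on S I"
    and refl: "\<And>p. p \<in> P \<Longrightarrow> le p p"
    and trans: "\<And>p q r. \<lbrakk>p \<in> P; q \<in> P; r \<in> P; le p q; le q r\<rbrakk> \<Longrightarrow> le p r"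
    and iso: "balg_isomorphic (quotient_algebra S I) (boolean_completion P le)"
  shows "\<exists>X. dense_system S I P le X"
proof -
  let ?c = "\<lambda>A. mod_ideal S I `` {A}"
  let ?RO = "{U. U \<subseteq> P \<and> int_cl P le U = U}"
  note eq = equiv_mod_ideal[OF I]
  obtain \<phi> where bij: "bij_betw \<phi> (Pow S // mod_ideal S I) ?RO"
    and meet: "\<And>x y. \<lbrakk>x \<in> Pow S // mod_ideal S I; y \<in> Pow S // mod_ideal S I\<rbrakk>
                 \<Longrightarrow> \<phi> (meet (quotient_algebra S I) x y) = \<phi> x \<inter> \<phi> y"
    and zero: "\<phi> (?c {}) = {}"
    using iso unfolding balg_isomorphic_def by (auto simp: quotient_algebra_def boolean_completion_def)
  have sub: "\<And>A B. A \<in> I \<Longrightarrow> B \<subseteq> A \<Longrightarrow> B \<in> I"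
    using I by (auto simp: ideal_on_def)
  have cl_in: "?c A \<in> Pow S // mod_ideal S I" if "A \<subseteq> S" for A
    using that by (auto intro: quotientI)
  define e where "e A = \<phi> (?c A)" for A
  have e_Int: "e (A \<inter> B) = e A \<inter> e B" if "A \<subseteq> S" "B \<subseteq> S" for A B
    using meet[OF cl_in[OF that(1)] cl_in[OF that(2)]] quotient_algebra_simps(1)[OF I that]
    by (simp add: e_def)
  have e_eq_iff: "e A = e B \<longleftrightarrow> (A - B) \<union> (B - A) \<in> I" if "A \<subseteq> S" "B \<subseteq> S" for A B
  proof -
    have "e A = e B \<longleftrightarrow> ?c A = ?c B"
      using bij_betw_imp_inj_on[OF bij] cl_in[OF that(1)] cl_in[OF that(2)]
      by (auto simp: e_def inj_on_def)
    also have "\<dots> \<longleftrightarrow> (A, B) \<in> mod_ideal S I"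
      using eq_equiv_class_iff[OF eq, of A B] that by simp
    finally show ?thesis
      using that by (simp add: mod_ideal_def)
  qed
  have e_empty: "e A = {} \<longleftrightarrow> A \<in> I" if "A \<subseteq> S" for A
    using e_eq_iff[OF that, of "{}"] zero by (simp add: e_def)
  have e_subset: "e A \<subseteq> e B \<longleftrightarrow> A - B \<in> I" if "A \<subseteq> S" "B \<subseteq> S" for A B
  proof -
    have "e A \<subseteq> e B \<longleftrightarrow> e (A \<inter> B) = e A"
      using e_Int[OF that] by auto
    also have "\<dots> \<longleftrightarrow> A - B \<in> I"
      using e_eq_iff[of "A \<inter> B" A] that by (simp add: Diff_Int Int_Diff le_infI1)
    finally show ?thesis .
  qed
  have down: "q \<in> U" if "U \<in> ?RO" "p \<in> U" "q \<in> P" "le q p" for U p q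
  proof -
    have "p \<in> int_cl P le U" "p \<in> P"
      using that(1,2) by auto
    then have "q \<in> int_cl P le U"
      using that(3,4) trans unfolding int_cl_def by blast
    then show ?thesis
      using that(1) by simp
  qed
  define C where "C p = int_cl P le {q \<in> P. le q p}" for p
  have C_self: "p \<in> C p" if "p \<in> P" for p
    using that refl unfolding C_def int_cl_def by blast
  \<comment> \<open>The interior of the closure is an idempotent operation on open sets.\<close>
  have C_RO: "C p \<in> ?RO" if "p \<in> P" for p
  proof -
    have "int_cl P le (C p) \<subseteq> C p"
    proof
      fix a assume a: "a \<in> int_cl P le (C p)"
      show "a \<in> C p"
        unfolding C_def int_cl_def
      proof (intro CollectI conjI ballI impI)
        show "a \<in> P" using a by (simp add: int_cl_def)
        fix b assume b: "b \<in> P" "le b a"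
        then obtain c where c: "c \<in> P" "le c b" "c \<in> C p"
          using a by (auto simp: int_cl_def)
        then obtain d where "d \<in> P" "le d c" "le d p"
          using refl[OF c(1)] by (auto simp: C_def int_cl_def)
        then show "\<exists>r\<in>P. le r b \<and> r \<in> {q \<in> P. le q p}"
          using trans b c by blast
      qed
    qed
    moreover have "C p \<subseteq> int_cl P le (C p)"
    proof
      fix a assume a: "a \<in> C p"
      have "b \<in> C p" if "b \<in> P" "le b a" for b
        using a that trans unfolding C_def int_cl_def by blast
      then show "a \<in> int_cl P le (C p)"
        using a refl unfolding int_cl_def C_def by blast
    qed
    moreover have "C p \<subseteq> P"
      by (auto simp: C_def int_cl_def)
    ultimately show ?thesis
      by blast
  qed
  have C_least: "C p \<subseteq> U" if "U \<in> ?RO" "p \<in> U" for p U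
  proof -
    have "C p \<subseteq> int_cl P le U"
      unfolding C_def int_cl_def using down[OF that] by blast
    then show ?thesis
      using that(1) by simp
  qed
  have "\<exists>A. A \<subseteq> S \<and> e A = C p" if "p \<in> P" for p
  proof -
    have "C p \<in> \<phi> ` (Pow S // mod_ideal S I)"
      using C_RO[OF that] bij_betw_imp_surj_on[OF bij] by simp
    then show ?thesis
      unfolding e_def by (auto elim!: quotientE)
  qed
  then obtain X where X: "\<And>p. p \<in> P \<Longrightarrow> X p \<subseteq> S" "\<And>p. p \<in> P \<Longrightarrow> e (X p) = C p"
    by metis
  have e_RO: "e A \<in> ?RO" if "A \<subseteq> S" for A
    using cl_in[OF that] bij_betw_imp_surj_on[OF bij] unfolding e_def by blast
  have "dense_system S I P le X"
    unfolding dense_system_def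
  proof (intro conjI ballI allI impI)
    fix p assume p: "p \<in> P"
    show "X p \<subseteq> S" using X(1)[OF p] .
    show "X p \<notin> I"
      using e_empty[OF X(1)[OF p]] X(2)[OF p] C_self[OF p] by auto
  next
    fix p q assume pq: "p \<in> P" "q \<in> P" "le p q"
    have "p \<in> C q"
      using down[OF C_RO[OF pq(2)] C_self[OF pq(2)] pq(1,3)] .
    then have "C p \<subseteq> C q"
      by (rule C_least[OF C_RO[OF pq(2)]])
    then show "X p - X q \<in> I"
      using e_subset X pq by metis
  next
    fix p q assume pq: "p \<in> P" "q \<in> P" "X p \<inter> X q \<notin> I"
    then have "C p \<inter> C q \<noteq> {}"
      using e_empty[of "X p \<inter> X q"] e_Int[of "X p" "X q"] X by auto
    then obtain a where a: "a \<in> P" "a \<in> C p" "a \<in> C q"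
      by (auto simp: C_def int_cl_def)
    obtain b where b: "b \<in> P" "le b a" "le b p"
      using a refl by (auto simp: C_def int_cl_def)
    obtain c where "c \<in> P" "le c b" "le c q"
      using a b by (auto simp: C_def int_cl_def)
    then show "\<exists>r\<in>P. le r p \<and> le r q"
      using trans b pq by blast
  next
    fix A assume A: "A \<subseteq> S \<and> A \<notin> I"
    then obtain p where p: "p \<in> e A"
      using e_empty by blast
    then have "p \<in> P" and "C p \<subseteq> e A"
      using e_RO[of A] C_least[OF e_RO p] A by auto
    then show "\<exists>p\<in>P. X p - A \<in> I"
      using e_subset[of "X p" A] X A by auto
  qed
  then show ?thesis by blast
qed

context omega_sequence
begin

text \<open>
  The index set is embedded in a bounded set of ordinals. Above that bound the union coincides with
  a diagonal union.
\<close>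

lemma normal_ideal_UN:
  assumes N: "normal_ideal (om (Suc n)) I"
    and J: "|J| \<le>o |K n|" and A: "\<And>j. j \<in> J \<Longrightarrow> A j \<in> I"
  shows "(\<Union>j\<in>J. A j) \<in> I"
proof -
  have id: "ideal_on (K (Suc n)) I"
    and bd: "\<And>\<beta>. \<beta> \<in> K (Suc n) \<Longrightarrow> below (Suc n) \<beta> \<in> I"
    and dg: "\<And>A. (\<And>\<xi>. \<xi> \<in> K (Suc n) \<Longrightarrow> A \<xi> \<in> I) \<Longrightarrow> diagonal_union (om (Suc n)) A \<in> I"
    using N by (auto simp: normal_ideal_def)
  have "|J| \<le>o |K (Suc n)|"
    using J K_mono[of n "Suc n"] ordLeq_transitive by force
  then obtain h where h: "inj_on h J" "h ` J \<subseteq> K (Suc n)"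
    using card_of_ordLeq by metis
  obtain y where y: "y \<in> K (Suc n)" "h ` J \<subseteq> below (Suc n) y"
    using ex_bound[OF h(2) image_ordLeq_K[OF J]] by blast
  obtain y' where y': "y' \<in> K (Suc n)" "y \<in> below (Suc n) y'"
    using ex_above[OF y(1)] by blast
  define B where "B \<xi> = (if \<xi> \<in> h ` J then A (the_inv_into J h \<xi>) else {})" for \<xi>
  have B: "B \<xi> \<in> I" for \<xi>
    using A id h(1) by (auto simp: B_def ideal_on_def the_inv_into_f_f)
  have "(\<Union>j\<in>J. A j) \<subseteq> below (Suc n) y' \<union> diagonal_union (om (Suc n)) B"
  proof
    fix \<beta> assume "\<beta> \<in> (\<Union>j\<in>J. A j)"
    then obtain j where j: "j \<in> J" "\<beta> \<in> A j" by blast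
    then have \<beta>: "\<beta> \<in> K (Suc n)"
      using A id by (auto simp: ideal_on_def)
    show "\<beta> \<in> below (Suc n) y' \<union> diagonal_union (om (Suc n)) B"
    proof (cases "\<beta> \<in> below (Suc n) y'")
      case False
      then have "\<beta> \<noteq> y" "\<beta> \<notin> below (Suc n) y"
        using y'(2) below_trans by blast+
      then have "y \<in> below (Suc n) \<beta>"
        using below_linear[OF y(1) \<beta>] by blast
      then have "h j \<in> below (Suc n) \<beta>"
        using y(2) j(1) below_trans by blast
      moreover have "\<beta> \<in> B (h j)"
        using j h(1) by (simp add: B_def the_inv_into_f_f)
      ultimately show ?thesis
        using \<beta> by (auto simp: diagonal_union_def)
    qed simp
  qed
  moreover have "below (Suc n) y' \<union> diagonal_union (om (Suc n)) B \<in> I"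
    using bd[OF y'(1)] dg[of B] B id by (auto simp: ideal_on_def)
  ultimately show ?thesis
    using id unfolding ideal_on_def by blast
qed

lemma normal_ideal_small:
  assumes N: "normal_ideal (om (Suc n)) I" and A: "A \<subseteq> K (Suc n)" "|A| \<le>o |K n|"
  shows "A \<in> I"
proof -
  obtain y where "y \<in> K (Suc n)" "A \<subseteq> below (Suc n) y"
    using ex_bound[OF A] by blast
  then show ?thesis
    using N unfolding normal_ideal_def ideal_on_def by blast
qed

abbreviation P :: "nat \<Rightarrow> ('a \<rightharpoonup> 'a) set" where
  "P n \<equiv> Col (om n) (om (Suc n))"

lemma Col_D:
  assumes "p \<in> P n"
  shows "dom p \<subseteq> K n" "ran p \<subseteq> K (Suc n)" "|dom p| <o |K n|"
  using assms ordLess_om_iff by (auto simp: Col_def)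

lemma Col_Suc_iff:
  "p \<in> P (Suc n) \<longleftrightarrow> dom p \<subseteq> K (Suc n) \<and> ran p \<subseteq> K (Suc (Suc n)) \<and> |dom p| \<le>o |K n|"
  using ordLess_om_Suc_iff by (auto simp: Col_def)

lemma empty_in_Col: "Map.empty \<in> P n"
  using finite_ordLess_K[of "{}"] ordLess_om_iff by (auto simp: Col_def)

lemma rev_incl_refl [simp]: "rev_incl p p"
  by (simp add: rev_incl_def)

lemma rev_incl_trans: "rev_incl p q \<Longrightarrow> rev_incl q r \<Longrightarrow> rev_incl p r"
  unfolding rev_incl_def using map_le_trans by blast

lemma rev_incl_SomeD: "rev_incl p q \<Longrightarrow> q x = Some y \<Longrightarrow> p x = Some y"
  by (auto simp: rev_incl_def map_le_def dom_def)

lemma rev_inclI: "(\<And>x y. q x = Some y \<Longrightarrow> p x = Some y) \<Longrightarrow> rev_incl p q"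
  by (auto simp: rev_incl_def map_le_def)

text \<open>
  The domain of the lower bound is recorded, because in \<open>generic_chain\<close> an ordinal in it must have
  been treated at an earlier stage.
\<close>

lemma Col_Union:
  assumes J: "|J| \<le>o |K n|" and r: "\<And>j. j \<in> J \<Longrightarrow> r j \<in> P (Suc n)"
    and chain: "\<And>i j. i \<in> J \<Longrightarrow> j \<in> J \<Longrightarrow> rev_incl (r i) (r j) \<or> rev_incl (r j) (r i)"
  shows "\<exists>u\<in>P (Suc n). (\<forall>j\<in>J. rev_incl u (r j)) \<and> dom u = (\<Union>j\<in>J. dom (r j))"
proof -
  define u where "u x = (if \<exists>j\<in>J. x \<in> dom (r j) then r (SOME j. j \<in> J \<and> x \<in> dom (r j)) x else None)" for x
  have u: "u x = Some y" if "j \<in> J" "r j x = Some y" for j x y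
  proof -
    have ex: "\<exists>j. j \<in> J \<and> x \<in> dom (r j)" using that by auto
    let ?k = "SOME j. j \<in> J \<and> x \<in> dom (r j)"
    have k: "?k \<in> J" "x \<in> dom (r ?k)"
      using someI_ex[OF ex] by blast+
    obtain z where z: "r ?k x = Some z"
      using k(2) by blast
    have "z = y"
      using chain[OF that(1) k(1)]
    proof
      assume "rev_incl (r j) (r ?k)"
      then have "r j x = Some z"
        using z by (rule rev_incl_SomeD)
      then show ?thesis
        using that(2) by simp
    next
      assume "rev_incl (r ?k) (r j)"
      then have "r ?k x = Some y"
        using that(2) by (rule rev_incl_SomeD)
      then show ?thesis
        using z by simp
    qed
    then have "r ?k x = r j x"
      using that(2) z by simp
    then show ?thesis
      using ex that by (auto simp: u_def)
  qed
  have u': "\<exists>j\<in>J. r j x = Some y" if "u x = Some y" for x y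
  proof -
    have ex: "\<exists>j. j \<in> J \<and> x \<in> dom (r j)"
      using that by (auto simp: u_def split: if_splits)
    then have "r (SOME j. j \<in> J \<and> x \<in> dom (r j)) x = Some y"
      using that by (simp add: u_def split: if_splits)
    then show ?thesis
      using someI_ex[OF ex] by blast
  qed
  have dom: "dom u = (\<Union>j\<in>J. dom (r j))"
    using u u' by (auto simp: dom_def) blast
  have "ran u \<subseteq> (\<Union>j\<in>J. ran (r j))"
    using u' by (auto simp: ran_def) blast
  then have ran: "ran u \<subseteq> K (Suc (Suc n))"
    using r Col_Suc_iff by blast
  have "|dom u| \<le>o |K n|"
    unfolding dom using r Col_Suc_iff by (intro UN_ordLeq_K[OF J]) blast
  moreover have "dom u \<subseteq> K (Suc n)"
    using r Col_Suc_iff dom by blast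
  ultimately have "u \<in> P (Suc n)"
    using ran Col_Suc_iff by blast
  then show ?thesis
    using dom u by (blast intro: rev_inclI)
qed

end

text \<open>
  The hypotheses of the theorem after the choice of ideals and isomorphisms. Note the shift of
  indices: \<open>I n\<close> is the ideal on \<open>\<omega>\<^sub>n\<^sub>+\<^sub>1\<close>.
\<close>

locale collapsing_ideals = omega_sequence om
  for om :: "nat \<Rightarrow> 'a rel" +
  fixes I :: "nat \<Rightarrow> 'a set set" and X :: "nat \<Rightarrow> ('a \<rightharpoonup> 'a) \<Rightarrow> 'a set"
  assumes normal: "normal_ideal (om (Suc n)) (I n)"
    and dense: "dense_system (K (Suc n)) (I n) (P n) rev_incl (X n)"
begin

lemma ideal: "ideal_on (K (Suc n)) (I n)"
  using normal by (simp add: normal_ideal_def)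

lemma I_subset: "A \<in> I n \<Longrightarrow> B \<subseteq> A \<Longrightarrow> B \<in> I n"
  using ideal[of n] by (auto simp: ideal_on_def)

lemma I_Un: "A \<in> I n \<Longrightarrow> B \<in> I n \<Longrightarrow> A \<union> B \<in> I n"
  using ideal[of n] by (auto simp: ideal_on_def)

lemma I_empty: "{} \<in> I n"
  using ideal[of n] by (auto simp: ideal_on_def)

lemmas I_UN = normal_ideal_UN[OF normal]
lemmas I_small = normal_ideal_small[OF normal]

lemma X_sub: "p \<in> P n \<Longrightarrow> X n p \<subseteq> K (Suc n)"
  and X_positive: "p \<in> P n \<Longrightarrow> X n p \<notin> I n"
  and X_mono: "p \<in> P n \<Longrightarrow> q \<in> P n \<Longrightarrow> rev_incl p q \<Longrightarrow> X n p - X n q \<in> I n"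
  and X_compatible: "p \<in> P n \<Longrightarrow> q \<in> P n \<Longrightarrow> X n p \<inter> X n q \<notin> I n
     \<Longrightarrow> \<exists>r\<in>P n. rev_incl r p \<and> rev_incl r q"
  and X_dense: "A \<subseteq> K (Suc n) \<Longrightarrow> A \<notin> I n \<Longrightarrow> \<exists>p\<in>P n. X n p - A \<in> I n"
  using dense[of n] by (auto simp: dense_system_def)

text \<open>
  This is the forcing relation of the quotient by \<open>I n\<close>: the generic ultrafilter determines an
  ordinal of the generic ultrapower, represented by the identity, and \<open>\<phi>\<close> is a property of it.
\<close>

definition forces :: "nat \<Rightarrow> ('a \<rightharpoonup> 'a) \<Rightarrow> ('a \<Rightarrow> bool) \<Rightarrow> bool" where
  "forces n p \<phi> \<longleftrightarrow> {\<xi> \<in> X n p. \<not> \<phi> \<xi>} \<in> I n"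

lemma forces_mono:
  assumes "p \<in> P n" "q \<in> P n" "rev_incl p q" "forces n q \<phi>"
  shows "forces n p \<phi>"
  unfolding forces_def
  by (rule I_subset[OF I_Un[OF X_mono[OF assms(1-3)] assms(4)[unfolded forces_def]]]) auto

lemma forces_weaken:
  assumes "forces n p \<phi>" "p \<in> P n" "\<And>\<xi>. \<xi> \<in> K (Suc n) \<Longrightarrow> \<phi> \<xi> \<Longrightarrow> \<psi> \<xi>"
  shows "forces n p \<psi>"
  using assms(1) X_sub[OF assms(2)] assms(3) I_subset unfolding forces_def
  by (smt (verit) Collect_mono_iff subsetD)

lemma forces_ball:
  assumes J: "|J| \<le>o |K n|" and "\<And>j. j \<in> J \<Longrightarrow> forces n p (\<phi> j)"
  shows "forces n p (\<lambda>\<xi>. \<forall>j\<in>J. \<phi> j \<xi>)"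
  unfolding forces_def
  by (rule I_subset[OF I_UN[OF J assms(2)[unfolded forces_def]]]) auto

lemma forces_conj:
  assumes "forces n p \<phi>" "forces n p \<psi>"
  shows "forces n p (\<lambda>\<xi>. \<phi> \<xi> \<and> \<psi> \<xi>)"
  unfolding forces_def
  by (rule I_subset[OF I_Un[OF assms[unfolded forces_def]]]) auto

lemma forces_ex:
  assumes "forces n p \<phi>" "p \<in> P n"
  shows "\<exists>\<xi>\<in>K (Suc n). \<phi> \<xi>"
proof (rule ccontr)
  assume "\<not> ?thesis"
  then have "{\<xi> \<in> X n p. \<not> \<phi> \<xi>} = X n p"
    using X_sub[OF assms(2)] by auto
  then show False
    using assms X_positive by (auto simp: forces_def)
qed

lemma forces_neq: "\<eta> \<in> K (Suc n) \<Longrightarrow> forces n p (\<lambda>\<xi>. \<xi> \<noteq> \<eta>)"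
  unfolding forces_def
  by (rule I_subset[OF I_small[of "{\<eta>}"]]) (auto intro: finite_ordLeq_K)

text \<open>
  As \<open>I n\<close> is complete for unions of \<open>\<omega>\<^sub>n\<close> sets, one of the preimages of the values is positive
  inside \<open>X n p\<close>, and by density it contains some \<open>X n q\<close> modulo \<open>I n\<close>. Then \<open>q\<close> is compatible with \<open>p\<close>.
\<close>

lemma forces_decide:
  assumes p: "p \<in> P n" and V: "|V| \<le>o |K n|" and f: "\<And>\<xi>. \<xi> \<in> K (Suc n) \<Longrightarrow> f \<xi> \<in> V"
  shows "\<exists>q\<in>P n. rev_incl q p \<and> (\<exists>v\<in>V. forces n q (\<lambda>\<xi>. f \<xi> = v))"
proof -
  have "\<exists>v\<in>V. {\<xi> \<in> X n p. f \<xi> = v} \<notin> I n"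
  proof (rule ccontr)
    assume "\<not> ?thesis"
    then have "(\<Union>v\<in>V. {\<xi> \<in> X n p. f \<xi> = v}) \<in> I n"
      by (intro I_UN[OF V]) blast
    moreover have "(\<Union>v\<in>V. {\<xi> \<in> X n p. f \<xi> = v}) = X n p"
      using f X_sub[OF p] by auto
    ultimately show False
      using X_positive[OF p] by simp
  qed
  then obtain v where v: "v \<in> V" "{\<xi> \<in> X n p. f \<xi> = v} \<notin> I n"
    by blast
  obtain q where q: "q \<in> P n" "X n q - {\<xi> \<in> X n p. f \<xi> = v} \<in> I n"
    using X_dense[OF _ v(2)] X_sub[OF p] by blast
  have "X n q \<inter> X n p \<notin> I n"
    using I_Un[OF q(2), of "X n q \<inter> X n p"] X_positive[OF q(1)] I_subset[of _ n "X n q"] by blast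
  then obtain r where r: "r \<in> P n" "rev_incl r q" "rev_incl r p"
    using X_compatible[OF q(1) p] by blast
  have "forces n q (\<lambda>\<xi>. f \<xi> = v)"
    unfolding forces_def by (rule I_subset[OF q(2)]) auto
  then show ?thesis
    using forces_mono r q(1) v(1) by blast
qed

text \<open>
  Conditions of \<open>P (Suc n)\<close> have lower bounds along sequences of length \<open>\<omega>\<^sub>n\<close>, so \<open>\<omega>\<^sub>n\<close> many
  questions can be decided at once. If \<open>\<omega>\<^sub>n\<close> had \<open>\<omega>\<^sub>n\<^sub>+\<^sub>2\<close> subsets, an injective enumeration of them
  would thus be constant on a positive set.
\<close>

lemma Pow_K_ordLeq: "|Pow (K n)| \<le>o |K (Suc n)|"
proof (rule ccontr)
  assume "\<not> ?thesis"
  then have "\<not> |Pow (K n)| <o |K (Suc (Suc n))|"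
    using ordLess_K_Suc_iff by blast
  then have "|K (Suc (Suc n))| \<le>o |Pow (K n)|"
    using ordLess_or_ordLeq[OF card_of_Well_order card_of_Well_order] by blast
  then obtain F where F: "inj_on F (K (Suc (Suc n)))" "F ` K (Suc (Suc n)) \<subseteq> Pow (K n)"
    using card_of_ordLeq by metis
  let ?P = "P (Suc n)"
  let ?dec = "\<lambda>r i. \<exists>b. forces (Suc n) r (\<lambda>\<xi>. (i \<in> F \<xi>) = b)"
  let ?good = "\<lambda>f i r. i \<in> K n \<longrightarrow> r \<in> ?P \<and> (\<forall>j\<in>below n i. rev_incl r (f j)) \<and> ?dec r i"
  have small: "|J| \<le>o |K n|" if "J \<subseteq> K n" for J
    using card_of_mono1[OF that] .
  have "\<exists>r. \<forall>i. ?good r i (r i)"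
  proof (rule dependent_wf_choice[OF wf_om[of n]])
    fix f g :: "'a \<Rightarrow> 'a \<rightharpoonup> 'a" and i r
    assume "\<And>z. (z, i) \<in> om n - Id \<Longrightarrow> f z = g z"
    then show "?good f i r = ?good g i r"
      using below_iff by metis
  next
    fix i and f :: "'a \<Rightarrow> 'a \<rightharpoonup> 'a"
    assume IH: "\<And>j. (j, i) \<in> om n - Id \<Longrightarrow> ?good f j (f j)"
    have IH': "?good f j (f j)" if "j \<in> below n i" for j
      using IH that below_iff by blast
    obtain u where u: "u \<in> ?P" "\<forall>j\<in>below n i. rev_incl u (f j)"
    proof -
      have "f j \<in> ?P" if "j \<in> below n i" for j
        using IH'[OF that] that below_subset by blast
      moreover have "rev_incl (f j) (f j') \<or> rev_incl (f j') (f j)"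
        if "j \<in> below n i" "j' \<in> below n i" for j j'
      proof -
        have K: "j \<in> K n" "j' \<in> K n"
          using that below_subset by blast+
        have "\<forall>k\<in>below n j. rev_incl (f j) (f k)" "\<forall>k\<in>below n j'. rev_incl (f j') (f k)"
          using IH'[OF that(1)] IH'[OF that(2)] K by simp_all
        then show ?thesis
          using below_linear[OF K] by (elim disjE) auto
      qed
      ultimately show ?thesis
        using Col_Union[OF small[OF below_subset], where r = f] that by blast
    qed
    obtain r where "r \<in> ?P" "rev_incl r u" "?dec r i"
      using forces_decide[OF u(1) finite_ordLeq_K[of "UNIV :: bool set"], of "\<lambda>\<xi>. i \<in> F \<xi>"] by auto
    then show "\<exists>r. ?good f i r"
      using u rev_incl_trans by blast
  qed
  then obtain r where r: "\<And>i. ?good r i (r i)" by blast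
  obtain u where u: "u \<in> ?P" "\<forall>j\<in>K n. rev_incl u (r j)"
  proof -
    have "rev_incl (r i) (r j) \<or> rev_incl (r j) (r i)" if "i \<in> K n" "j \<in> K n" for i j
      using below_linear[OF that] r[of i] r[of j] that by (elim disjE) auto
    then show ?thesis
      using Col_Union[OF small[OF order.refl], where r = r] r that by blast
  qed
  have "?dec u i" if "i \<in> K n" for i
    using r[of i] that u forces_mono by blast
  then obtain b where "forces (Suc n) u (\<lambda>\<xi>. (i \<in> F \<xi>) = b i)" if "i \<in> K n" for i
    by metis
  then have b: "forces (Suc n) u (\<lambda>\<xi>. \<forall>i\<in>K n. (i \<in> F \<xi>) = b i)"
    using K_mono[of n "Suc n"] by (intro forces_ball) auto
  obtain \<eta> where \<eta>: "\<eta> \<in> K (Suc (Suc n))" "\<forall>i\<in>K n. (i \<in> F \<eta>) = b i"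
    using forces_ex[OF b u(1)] by blast
  obtain \<xi> where \<xi>: "\<xi> \<in> K (Suc (Suc n))" "\<forall>i\<in>K n. (i \<in> F \<xi>) = b i" "\<xi> \<noteq> \<eta>"
    using forces_ex[OF forces_conj[OF b forces_neq[OF \<eta>(1)]] u(1)] by blast
  have "F \<xi> = F \<eta>"
    using F(2) \<xi>(1,2) \<eta> by blast
  then show False
    using F(1) \<xi> \<eta> by (auto simp: inj_on_def)
qed

lemma PiE_K_ordLeq:
  assumes "|A| \<le>o |K (Suc n)|"
  shows "|K n \<rightarrow>\<^sub>E A| \<le>o |K (Suc n)|"
  using ordLeq_transitive[OF PiE_K_ordLeq_Pow[OF ordLeq_transitive[OF assms K_Suc_ordLeq_Pow]]
      Pow_K_ordLeq] .

lemma card_of_Col: "|P n| \<le>o |K (Suc n)|"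
proof -
  let ?V = "insert None (Some ` K (Suc n))"
  have "|?V| \<le>o |K (Suc n)|"
    using Un_ordLeq_K[OF finite_ordLeq_K[of "{None}"] image_ordLeq_K[OF card_of_mono1[OF order.refl]]]
    by (metis insert_is_Un finite.emptyI finite.insertI)
  then have "|K n \<rightarrow>\<^sub>E ?V| \<le>o |K (Suc n)|"
    by (rule PiE_K_ordLeq)
  moreover have "inj_on (\<lambda>p. restrict p (K n)) (P n)"
  proof (rule inj_onI)
    fix p q assume pq: "p \<in> P n" "q \<in> P n" and eq: "restrict p (K n) = restrict q (K n)"
    show "p = q"
    proof
      fix x
      show "p x = q x"
      proof (cases "x \<in> K n")
        case True
        then show ?thesis using fun_cong[OF eq, of x] by simp
      next
        case False
        then have "x \<notin> dom p" "x \<notin> dom q" using Col_D(1) pq by blast+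
        then show ?thesis by (auto simp: dom_def)
      qed
    qed
  qed
  moreover have "(\<lambda>p. restrict p (K n)) ` P n \<subseteq> K n \<rightarrow>\<^sub>E ?V"
  proof -
    have "p x \<in> ?V" if "p \<in> P n" for p x
    proof (cases "p x")
      case (Some y)
      then show ?thesis
        using Col_D(2)[OF that] ranI[of p x y] by blast
    qed simp
    then show ?thesis
      by (intro image_subsetI restrict_PiE_iff[THEN iffD2] ballI)
  qed
  ultimately show ?thesis
    using card_of_ordLeq ordLeq_transitive by metis
qed

end

section \<open>A generic chain of sequences of conditions\<close>

context collapsing_ideals
begin

text \<open>
  The function \<open>\<lambda>\<xi>. h \<xi>\<close> represents the generic function that is added by the collapse: conditions
  force that it extends them. Different conditions with domain \<open>{\<delta>}\<close> are represented by almost disjoint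
  sets, and taking the least \<open>v\<close> such that \<open>\<xi>\<close> is in the set for \<open>v\<close> makes these sets disjoint.
\<close>

lemma generic_function:
  "\<exists>h. \<forall>p\<in>P n. forces n p (\<lambda>\<xi>. \<forall>\<delta>\<in>dom p. p \<delta> = Some (h \<xi> \<delta>))"
proof -
  define least where "least \<xi> \<delta> v \<longleftrightarrow> v \<in> K (Suc n) \<and> \<xi> \<in> X n [\<delta> \<mapsto> v] \<and>
    (\<forall>t\<in>below (Suc n) v. \<xi> \<notin> X n [\<delta> \<mapsto> t])" for \<xi> \<delta> v
  define h where "h \<xi> \<delta> = (SOME v. least \<xi> \<delta> v)" for \<xi> \<delta>
  have h: "h \<xi> \<delta> = v" if v: "least \<xi> \<delta> v" for \<xi> \<delta> v
    unfolding h_def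
  proof (rule some_equality)
    fix v' assume v': "least \<xi> \<delta> v'"
    then show "v' = v"
      using v below_linear[of v "Suc n" v'] unfolding least_def by blast
  qed (rule v)
  have single: "[\<delta> \<mapsto> v] \<in> P n" if "\<delta> \<in> K n" "v \<in> K (Suc n)" for \<delta> v
    using finite_ordLess_K[of "{\<delta>}"] that ordLess_om_iff by (auto simp: Col_def)
  have "forces n p (\<lambda>\<xi>. p \<delta> = Some (h \<xi> \<delta>))" if p: "p \<in> P n" and \<delta>: "\<delta> \<in> dom p" for p \<delta>
  proof -
    obtain v where v: "p \<delta> = Some v" using \<delta> by blast
    have in_K: "\<delta> \<in> K n" "v \<in> K (Suc n)"
      using Col_D(1,2)[OF p] \<delta> v by (auto simp: ran_def)
    have t_K: "t \<in> K (Suc n)" if "t \<in> below (Suc n) v" for t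
      using that below_subset by blast
    have 1: "X n p - X n [\<delta> \<mapsto> v] \<in> I n"
      using v by (intro X_mono[OF p single[OF in_K]] rev_inclI) (auto split: if_splits)
    have "X n [\<delta> \<mapsto> v] \<inter> X n [\<delta> \<mapsto> t] \<in> I n" if t: "t \<in> below (Suc n) v" for t
    proof (rule ccontr)
      assume "\<not> ?thesis"
      then obtain r where "rev_incl r [\<delta> \<mapsto> v]" "rev_incl r [\<delta> \<mapsto> t]"
        using X_compatible[OF single[OF in_K] single[OF in_K(1) t_K[OF t]]] by blast
      then have "r \<delta> = Some v" "r \<delta> = Some t"
        by (auto dest: rev_incl_SomeD)
      then show False
        using t below_irrefl by auto
    qed
    then have 2: "(\<Union>t\<in>below (Suc n) v. X n [\<delta> \<mapsto> v] \<inter> X n [\<delta> \<mapsto> t]) \<in> I n"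
      by (rule I_UN[OF below_Suc_ordLeq[OF in_K(2)]])
    have "{\<xi> \<in> X n p. p \<delta> \<noteq> Some (h \<xi> \<delta>)} \<subseteq>
        (X n p - X n [\<delta> \<mapsto> v]) \<union> (\<Union>t\<in>below (Suc n) v. X n [\<delta> \<mapsto> v] \<inter> X n [\<delta> \<mapsto> t])"
      using h[of _ \<delta> v] v in_K(2) unfolding least_def by auto
    then show ?thesis
      unfolding forces_def by (rule I_subset[OF I_Un[OF 1 2]])
  qed
  then have "forces n p (\<lambda>\<xi>. \<forall>\<delta>\<in>dom p. p \<delta> = Some (h \<xi> \<delta>))" if "p \<in> P n" for p
    using that by (intro forces_ball card_of_mono1[OF Col_D(1)]) auto
  then show ?thesis by blast
qed

abbreviation comparable :: "('a \<rightharpoonup> 'a) \<Rightarrow> ('a \<rightharpoonup> 'a) \<Rightarrow> bool" where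
  "comparable p q \<equiv> rev_incl p q \<or> rev_incl q p"

text \<open>
  Modulo \<open>I m\<close>, these sequences represent the elements of the ultrapower of \<open>P (Suc m)\<close> by a generic
  ultrafilter on \<open>\<omega>\<^sub>m\<^sub>+\<^sub>1\<close>, but working with the ideal instead of an ultrafilter provides lower bounds
  for chains of length \<open>\<omega>\<^sub>m\<^sub>+\<^sub>1\<close>.
\<close>

definition Q :: "nat \<Rightarrow> ('a \<Rightarrow> 'a \<rightharpoonup> 'a) set" where
  "Q m = K (Suc m) \<rightarrow>\<^sub>E P (Suc m)"

definition le_ae :: "nat \<Rightarrow> ('a \<Rightarrow> 'a \<rightharpoonup> 'a) \<Rightarrow> ('a \<Rightarrow> 'a \<rightharpoonup> 'a) \<Rightarrow> bool" where
  "le_ae m q q' \<longleftrightarrow> {x \<in> K (Suc m). \<not> rev_incl (q x) (q' x)} \<in> I m"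

lemma Q_D: "q \<in> Q m \<Longrightarrow> x \<in> K (Suc m) \<Longrightarrow> q x \<in> P (Suc m)"
  by (auto simp: Q_def)

lemma card_of_Q: "|Q m| \<le>o |K (Suc (Suc m))|"
  unfolding Q_def by (rule PiE_K_ordLeq[OF card_of_Col])

lemma le_ae_refl: "le_ae m q q"
  using I_empty by (simp add: le_ae_def)

lemma le_ae_trans:
  assumes "le_ae m p q" "le_ae m q r"
  shows "le_ae m p r"
  unfolding le_ae_def
  by (rule I_subset[OF I_Un[OF assms[unfolded le_ae_def]]]) (auto intro: rev_incl_trans)

text \<open>
  At each \<open>x\<close> a lower bound has to respect only the members \<open>l w\<close> with \<open>w\<close> below \<open>x\<close>. These are fewer than
  \<open>\<omega>\<^sub>m\<^sub>+\<^sub>1\<close> conditions, and for almost all \<open>x\<close> they form a chain, by normality.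
\<close>

lemma le_ae_diagonal:
  assumes chain: "\<And>w w'. w \<in> K (Suc m) \<Longrightarrow> w' \<in> K (Suc m) \<Longrightarrow> le_ae m (l w) (l w') \<or> le_ae m (l w') (l w)"
    and q: "\<And>x w. \<lbrakk>x \<in> K (Suc m); \<forall>u\<in>below (Suc m) x. \<forall>v\<in>below (Suc m) x. comparable (l u x) (l v x);
              w \<in> below (Suc m) x\<rbrakk> \<Longrightarrow> rev_incl (q x) (l w x)"
    and w: "w \<in> K (Suc m)"
  shows "le_ae m q (l w)"
proof -
  \<comment> \<open>The points at which \<open>l v\<close> fails to be comparable to an earlier member.\<close>
  define B where "B v = (\<Union>u\<in>below (Suc m) v. {x \<in> K (Suc m). \<not> comparable (l u x) (l v x)})" for v
  have "{x \<in> K (Suc m). \<not> comparable (l u x) (l v x)} \<in> I m"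
    if uv: "u \<in> K (Suc m)" "v \<in> K (Suc m)" for u v
    using chain[OF uv]
  proof
    assume "le_ae m (l u) (l v)"
    then show ?thesis
      unfolding le_ae_def by (rule I_subset) auto
  next
    assume "le_ae m (l v) (l u)"
    then show ?thesis
      unfolding le_ae_def by (rule I_subset) auto
  qed
  then have "B v \<in> I m" if "v \<in> K (Suc m)" for v
    unfolding B_def using below_subset[of "Suc m" v] that
    by (intro I_UN[OF below_Suc_ordLeq[OF that]]) blast
  then have D: "diagonal_union (om (Suc m)) B \<in> I m"
    using normal[of m] by (auto simp: normal_ideal_def)
  have small: "below (Suc m) w \<union> {w} \<in> I m"
    using w below_subset
    by (intro I_small Un_ordLeq_K below_Suc_ordLeq finite_ordLeq_K) auto
  have "{x \<in> K (Suc m). \<not> rev_incl (q x) (l w x)} \<subseteq> diagonal_union (om (Suc m)) B \<union> (below (Suc m) w \<union> {w})"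
  proof
    fix x assume "x \<in> {x \<in> K (Suc m). \<not> rev_incl (q x) (l w x)}"
    then have x: "x \<in> K (Suc m)" "\<not> rev_incl (q x) (l w x)" by auto
    show "x \<in> diagonal_union (om (Suc m)) B \<union> (below (Suc m) w \<union> {w})"
    proof (rule ccontr)
      assume *: "\<not> ?thesis"
      have w': "w \<in> below (Suc m) x"
        using below_linear[OF w x(1)] * by blast
      have notB: "x \<notin> B v" if "v \<in> below (Suc m) x" for v
        using * that x(1) by (auto simp: diagonal_union_def)
      have cmp: "comparable (l u x) (l v x)" if "u \<in> below (Suc m) v" "v \<in> below (Suc m) x" for u v
        using notB[OF that(2)] that(1) x(1) unfolding B_def by blast
      have "comparable (l u x) (l v x)" if "u \<in> below (Suc m) x" "v \<in> below (Suc m) x" for u v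
      proof -
        have "u \<in> K (Suc m)" "v \<in> K (Suc m)"
          using that below_subset by blast+
        then have "u \<in> below (Suc m) v \<or> u = v \<or> v \<in> below (Suc m) u"
          by (rule below_linear)
        then show ?thesis
          using cmp that rev_incl_refl by blast
      qed
      then show False
        using q[OF x(1) _ w'] x(2) by blast
    qed
  qed
  then show ?thesis
    unfolding le_ae_def by (rule I_subset[OF I_Un[OF D small]])
qed

lemma le_ae_lower_bound:
  assumes L: "L \<subseteq> Q m" "|L| \<le>o |K (Suc m)|"
    and chain: "\<And>l l'. l \<in> L \<Longrightarrow> l' \<in> L \<Longrightarrow> le_ae m l l' \<or> le_ae m l' l"
  shows "\<exists>q\<in>Q m. \<forall>l\<in>L. le_ae m q l"
proof (cases "L = {}")
  case True
  have "restrict (\<lambda>_. Map.empty) (K (Suc m)) \<in> Q m"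
    unfolding Q_def using empty_in_Col by auto
  then show ?thesis using True by blast
next
  case False
  then obtain l where l: "l ` K (Suc m) = L"
    using L(2) card_of_ordLeq2 by metis
  have lQ: "l w x \<in> P (Suc m)" if "w \<in> K (Suc m)" "x \<in> K (Suc m)" for w x
    using that l L(1) Q_D by blast
  have "\<exists>u\<in>P (Suc m). (\<forall>u\<in>below (Suc m) x. \<forall>v\<in>below (Suc m) x. comparable (l u x) (l v x)) \<longrightarrow>
          (\<forall>w\<in>below (Suc m) x. rev_incl u (l w x))" if x: "x \<in> K (Suc m)" for x
  proof (cases "\<forall>u\<in>below (Suc m) x. \<forall>v\<in>below (Suc m) x. comparable (l u x) (l v x)")
    case True
    have "l w x \<in> P (Suc m)" if "w \<in> below (Suc m) x" for w
      using lQ x that below_subset by blast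
    then show ?thesis
      using Col_Union[OF below_Suc_ordLeq[OF x], where r = "\<lambda>w. l w x"] True by blast
  next
    case False
    then show ?thesis using empty_in_Col by blast
  qed
  then obtain q where q: "\<And>x. x \<in> K (Suc m) \<Longrightarrow> q x \<in> P (Suc m)"
    "\<And>x w. \<lbrakk>x \<in> K (Suc m); \<forall>u\<in>below (Suc m) x. \<forall>v\<in>below (Suc m) x. comparable (l u x) (l v x);
        w \<in> below (Suc m) x\<rbrakk> \<Longrightarrow> rev_incl (q x) (l w x)"
    by metis
  have "le_ae m (restrict q (K (Suc m))) (l w)" if "w \<in> K (Suc m)" for w
    using that l chain q(2) by (intro le_ae_diagonal) auto
  moreover have "restrict q (K (Suc m)) \<in> Q m"
    unfolding Q_def using q(1) by auto
  ultimately show ?thesis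
    using l by blast
qed

text \<open>
  An arbitrary sequence \<open>s\<close> contains a descending one: a member is good if it lies below all earlier
  good ones. Whether \<open>\<delta>\<close> is good depends only on the restriction of \<open>s\<close> to \<open>{..\<delta>}\<close>, so it can be decided
  by a condition. The value \<open>None\<close> is never good and serves to fill gaps.
\<close>

definition good :: "nat \<Rightarrow> ('a \<Rightarrow> ('a \<Rightarrow> 'a \<rightharpoonup> 'a) option) \<Rightarrow> 'a \<Rightarrow> bool" where
  "good m s = wfrec (om (Suc (Suc m)) - Id)
     (\<lambda>G \<delta>. \<exists>q\<in>Q m. s \<delta> = Some q \<and>
        (\<forall>\<gamma>\<in>below (Suc (Suc m)) \<delta>. \<forall>q'. s \<gamma> = Some q' \<longrightarrow> G \<gamma> \<longrightarrow> le_ae m q q'))"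

lemma good_iff:
  "good m s \<delta> \<longleftrightarrow> (\<exists>q\<in>Q m. s \<delta> = Some q \<and>
     (\<forall>\<gamma>\<in>below (Suc (Suc m)) \<delta>. \<forall>q'. s \<gamma> = Some q' \<longrightarrow> good m s \<gamma> \<longrightarrow> le_ae m q q'))"
  by (subst good_def, subst wfrec[OF wf_om]) (simp add: good_def cut_apply below_iff)

lemma good_cong:
  "(\<And>\<gamma>. \<gamma> \<in> below (Suc (Suc m)) \<delta> \<union> {\<delta>} \<Longrightarrow> s \<gamma> = s' \<gamma>) \<Longrightarrow> good m s \<delta> = good m s' \<delta>"
proof (induction \<delta> rule: wf_induct_rule[OF wf_om[of "Suc (Suc m)"]])
  case (1 \<delta>)
  have "good m s \<gamma> = good m s' \<gamma>" if \<gamma>: "\<gamma> \<in> below (Suc (Suc m)) \<delta>" for \<gamma>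
  proof (rule 1(1))
    show "(\<gamma>, \<delta>) \<in> om (Suc (Suc m)) - Id"
      using \<gamma> below_iff by blast
    show "s \<beta> = s' \<beta>" if "\<beta> \<in> below (Suc (Suc m)) \<gamma> \<union> {\<gamma>}" for \<beta>
      using that \<gamma> below_trans 1(2) by blast
  qed
  then show ?case
    using 1(2) by (subst (1 2) good_iff) auto
qed

lemma good_le_ae:
  assumes "good m s \<delta>" "s \<delta> = Some q" "\<gamma> \<in> below (Suc (Suc m)) \<delta>" "good m s \<gamma>" "s \<gamma> = Some q'"
  shows "le_ae m q q'"
  using assms(1)[unfolded good_iff[of m s \<delta>]] assms by auto

definition good_values :: "nat \<Rightarrow> ('a \<Rightarrow> ('a \<Rightarrow> 'a \<rightharpoonup> 'a) option) \<Rightarrow> ('a \<Rightarrow> 'a \<rightharpoonup> 'a) set" where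
  "good_values m s = {q. \<exists>\<delta>\<in>K (Suc (Suc m)). good m s \<delta> \<and> s \<delta> = Some q}"

lemma good_values_Q: "good_values m s \<subseteq> Q m"
proof
  fix q assume "q \<in> good_values m s"
  then obtain \<delta> where "good m s \<delta>" "s \<delta> = Some q"
    unfolding good_values_def by blast
  then show "q \<in> Q m"
    using good_iff[of m s \<delta>] by auto
qed

lemma good_values_chain:
  assumes "q \<in> good_values m s" "q' \<in> good_values m s"
  shows "le_ae m q q' \<or> le_ae m q' q"
proof -
  obtain \<delta> \<delta>' where d: "\<delta> \<in> K (Suc (Suc m))" "good m s \<delta>" "s \<delta> = Some q"
    "\<delta>' \<in> K (Suc (Suc m))" "good m s \<delta>'" "s \<delta>' = Some q'"
    using assms unfolding good_values_def by blast
  show ?thesis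
    using below_linear[OF d(1,4)] good_le_ae[OF d(2,3) _ d(5,6)] good_le_ae[OF d(5,6) _ d(2,3)]
      d(3,6) le_ae_refl by (elim disjE) auto
qed

definition dense_in :: "('a \<rightharpoonup> 'a) set \<Rightarrow> nat \<Rightarrow> bool" where
  "dense_in D n \<longleftrightarrow> D \<subseteq> P n \<and> (\<forall>p\<in>P n. \<exists>d\<in>D. rev_incl d p)"

text \<open>
  Every condition extends to one whose domain is an initial segment with a prescribed last value \<open>b\<close>.
\<close>

lemma Col_fill:
  assumes u: "u \<in> P (Suc n)" and \<delta>: "\<delta> \<in> K (Suc n)" "dom u \<subseteq> below (Suc n) \<delta>"
    and v: "a \<in> K (Suc (Suc n))" "b \<in> K (Suc (Suc n))"
    and r: "r = (\<lambda>\<gamma>. if \<gamma> \<in> below (Suc n) \<delta> then Some (case u \<gamma> of None \<Rightarrow> a | Some v \<Rightarrow> v)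
                   else if \<gamma> = \<delta> then Some b else None)"
  shows "r \<in> P (Suc n)" and "rev_incl r u" and "dom r = below (Suc n) \<delta> \<union> {\<delta>}"
proof -
  show dom: "dom r = below (Suc n) \<delta> \<union> {\<delta>}"
    by (auto simp: r dom_def below_irrefl)
  have "ran r \<subseteq> ran u \<union> {a, b}"
    by (auto simp: r ran_def split: if_splits option.splits)
  moreover have "ran u \<subseteq> K (Suc (Suc n))"
    using u Col_Suc_iff by blast
  moreover have "|below (Suc n) \<delta> \<union> {\<delta>}| \<le>o |K n|"
    using \<delta>(1) by (intro Un_ordLeq_K below_Suc_ordLeq finite_ordLeq_K) auto
  moreover have "below (Suc n) \<delta> \<union> {\<delta>} \<subseteq> K (Suc n)"
    using \<delta>(1) below_subset by blast
  ultimately show "r \<in> P (Suc n)"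
    using v unfolding Col_Suc_iff dom by blast
  show "rev_incl r u"
    using \<delta>(2) by (intro rev_inclI) (auto simp: r)
qed

text \<open>
  Each \<open>\<xi>\<close> below \<open>\<omega>\<^sub>m\<^sub>+\<^sub>3\<close> yields a sequence \<open>s \<xi>\<close> of length \<open>\<omega>\<^sub>m\<^sub>+\<^sub>2\<close>, by decoding the values of the generic
  function, and thus a chain of good members of \<open>s \<xi>\<close>. If all these chains fail, let \<open>D (s \<xi>)\<close> be a dense
  set that is not met by the chain for \<open>\<xi>\<close>.

  A descending sequence of conditions of length \<open>\<omega>\<^sub>m\<^sub>+\<^sub>1\<close> leads to a contradiction. In stage \<open>x\<close> let \<open>v\<close> be
  a lower bound of the entries at \<open>x\<close> of the good members that were introduced before. Since \<open>P (Suc m)\<close>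
  has only \<open>\<omega>\<^sub>m\<^sub>+\<^sub>2\<close> elements, a condition decides an extension \<open>e\<close> of \<open>v\<close> in \<open>D (s \<xi>)\<close>. This condition may
  introduce unforeseen good members; it is extended such that a lower bound of all of them is
  good. In the end, the entries \<open>e\<close> form a sequence \<open>q\<close> below all good members so far, and all its
  entries are forced to be in \<open>D (s \<xi>)\<close>. So \<open>q\<close> can be made the next good member.
\<close>

lemma generic_chain:
  "\<exists>G\<subseteq>Q m. (\<forall>q\<in>G. \<forall>q'\<in>G. le_ae m q q' \<or> le_ae m q' q) \<and>
     (\<forall>D. dense_in D (Suc m) \<longrightarrow> (\<exists>q\<in>G. \<forall>x\<in>K (Suc m). q x \<in> D))"
proof (rule ccontr)
  assume none: "\<not> ?thesis"
  have "\<exists>D. dense_in D (Suc m) \<and> (\<forall>q\<in>good_values m s. \<exists>x\<in>K (Suc m). q x \<notin> D)" for s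
  proof (rule ccontr)
    assume *: "\<not> ?thesis"
    have all: "\<forall>D. dense_in D (Suc m) \<longrightarrow> (\<exists>q\<in>good_values m s. \<forall>x\<in>K (Suc m). q x \<in> D)"
      using * by blast
    show False
      by (rule notE[OF none], intro exI[of _ "good_values m s"] conjI ballI good_values_Q
          good_values_chain all)
  qed
  then obtain D where D: "\<And>s. dense_in (D s) (Suc m)"
    and missed: "\<And>s q. q \<in> good_values m s \<Longrightarrow> \<exists>x\<in>K (Suc m). q x \<notin> D s"
    by metis
  let ?n = "Suc (Suc m)"
  obtain h where h: "\<And>p. p \<in> P ?n \<Longrightarrow> forces ?n p (\<lambda>\<xi>. \<forall>\<delta>\<in>dom p. p \<delta> = Some (h \<xi> \<delta>))"
    using generic_function by blast
  let ?V = "insert None (Some ` Q m)"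
  have "|?V| \<le>o |K (Suc ?n)|"
  proof -
    have "|{None} \<union> Some ` Q m| \<le>o |K ?n|"
      by (intro Un_ordLeq_K image_ordLeq_K card_of_Q finite_ordLeq_K) simp
    then show ?thesis
      using K_mono[of ?n "Suc ?n"] ordLeq_transitive by auto
  qed
  then obtain c where c: "inj_on c ?V" "c ` ?V \<subseteq> K (Suc ?n)"
    using card_of_ordLeq by metis
  define decode where "decode = the_inv_into ?V c"
  have decode: "decode (c v) = v" if "v \<in> ?V" for v
    using the_inv_into_f_f[OF c(1) that] by (simp add: decode_def)
  have c_K: "c v \<in> K (Suc ?n)" if "v \<in> ?V" for v
    using c(2) that by blast
  define seq where "seq r \<gamma> = (case r \<gamma> of None \<Rightarrow> None | Some v \<Rightarrow> decode v)" for r :: "'a \<rightharpoonup> 'a" and \<gamma>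
  define s where "s \<xi> \<gamma> = decode (h \<xi> \<gamma>)" for \<xi> \<gamma>
  \<comment> \<open>A stage consists of a condition, the last ordinal of its domain, and an entry of the final sequence.\<close>
  define R where "R y = fst y" for y :: "('a \<rightharpoonup> 'a) \<times> 'a \<times> ('a \<rightharpoonup> 'a)"
  define d where "d y = fst (snd y)" for y :: "('a \<rightharpoonup> 'a) \<times> 'a \<times> ('a \<rightharpoonup> 'a)"
  define e where "e y = snd (snd y)" for y :: "('a \<rightharpoonup> 'a) \<times> 'a \<times> ('a \<rightharpoonup> 'a)"
  define top where "top y = the (seq (R y) (d y))" for y
  define chain_at where "chain_at f x \<longleftrightarrow>
    (\<forall>u\<in>below (Suc m) x. \<forall>v\<in>below (Suc m) x. comparable (top (f u) x) (top (f v) x))" for f x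
  \<comment> \<open>The entries form a chain only at almost all \<open>x\<close>; elsewhere \<open>e y\<close> is unrestricted.\<close>
  define stage where "stage f x y \<longleftrightarrow> (x \<in> K (Suc m) \<longrightarrow>
    R y \<in> P ?n \<and> d y \<in> K ?n \<and> dom (R y) = below ?n (d y) \<union> {d y} \<and>
    good m (seq (R y)) (d y) \<and>
    (\<forall>z\<in>below (Suc m) x. rev_incl (R y) (R (f z)) \<and> d (f z) \<in> below ?n (d y)) \<and>
    e y \<in> P (Suc m) \<and>
    (chain_at f x \<longrightarrow> (\<forall>z\<in>below (Suc m) x. rev_incl (e y) (top (f z) x))) \<and>
    forces ?n (R y) (\<lambda>\<xi>. e y \<in> D (s \<xi>)))" for f x y
  have top: "seq (R y) (d y) = Some (top y)" "top y \<in> Q m" if "good m (seq (R y)) (d y)" for y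
    using that good_iff[of m "seq (R y)" "d y"] by (auto simp: top_def)
  have seq_mono: "seq r' \<gamma> = seq r \<gamma>" if "rev_incl r' r" "\<gamma> \<in> dom r" for r r' \<gamma>
  proof -
    from that(2) obtain v where v: "r \<gamma> = Some v" by blast
    show ?thesis
      using rev_incl_SomeD[OF that(1) v] v by (simp add: seq_def)
  qed
  have extend: "\<exists>y. stage f x y" if x: "x \<in> K (Suc m)"
    and IH: "\<And>z. z \<in> below (Suc m) x \<Longrightarrow> stage f z (f z)" for f x
  proof -
    have z_K: "z \<in> K (Suc m)" if "z \<in> below (Suc m) x" for z
      using that below_subset by blast
    have z_R: "R (f z) \<in> P ?n" "d (f z) \<in> K ?n" "good m (seq (R (f z))) (d (f z))"
      "dom (R (f z)) = below ?n (d (f z)) \<union> {d (f z)}"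
      if "z \<in> below (Suc m) x" for z
      using IH[OF that] z_K[OF that] unfolding stage_def by blast+
    have lin: "comparable (R (f z)) (R (f z'))"
      if "z \<in> below (Suc m) x" "z' \<in> below (Suc m) x" for z z'
    proof -
      have "\<forall>w\<in>below (Suc m) z. rev_incl (R (f z)) (R (f w))"
        "\<forall>w\<in>below (Suc m) z'. rev_incl (R (f z')) (R (f w))"
        using IH[OF that(1)] IH[OF that(2)] z_K[OF that(1)] z_K[OF that(2)] unfolding stage_def by blast+
      then show ?thesis
        using below_linear[OF z_K[OF that(1)] z_K[OF that(2)]] by (elim disjE) auto
    qed
    have "|below (Suc m) x| \<le>o |K (Suc m)|"
      by (rule card_of_mono1[OF below_subset])
    then obtain u where u: "u \<in> P ?n" "\<And>z. z \<in> below (Suc m) x \<Longrightarrow> rev_incl u (R (f z))"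
      using Col_Union[where r = "\<lambda>z. R (f z)" and J = "below (Suc m) x" and n = "Suc m"] z_R(1) lin
      by blast
    have "\<exists>v\<in>P (Suc m). chain_at f x \<longrightarrow> (\<forall>z\<in>below (Suc m) x. rev_incl v (top (f z) x))"
    proof (cases "chain_at f x")
      case True
      have "top (f z) x \<in> P (Suc m)" if "z \<in> below (Suc m) x" for z
        using Q_D[OF top(2)[OF z_R(3)[OF that]] x] .
      then show ?thesis
        using Col_Union[OF below_Suc_ordLeq[OF x], where r = "\<lambda>z. top (f z) x"] True
        unfolding chain_at_def by blast
    next
      case False
      then show ?thesis using empty_in_Col by blast
    qed
    then obtain v where v: "v \<in> P (Suc m)"
      "chain_at f x \<Longrightarrow> z \<in> below (Suc m) x \<Longrightarrow> rev_incl v (top (f z) x)" for z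
      by blast
    have "\<exists>a. a \<in> D (s \<xi>) \<and> rev_incl a v" for \<xi>
      using D[of "s \<xi>"] v(1) unfolding dense_in_def by blast
    then obtain a where a: "\<And>\<xi>. a \<xi> \<in> D (s \<xi>)" "\<And>\<xi>. rev_incl (a \<xi>) v"
      by metis
    let ?A = "{b \<in> P (Suc m). rev_incl b v}"
    have "|?A| \<le>o |K ?n|"
      by (rule subset_ordLeq_K[OF _ card_of_Col]) auto
    moreover have "a \<xi> \<in> ?A" for \<xi>
      using a D[of "s \<xi>"] unfolding dense_in_def by blast
    ultimately have "\<exists>w\<in>P ?n. rev_incl w u \<and> (\<exists>b\<in>?A. forces ?n w (\<lambda>\<xi>. a \<xi> = b))"
      by (rule forces_decide[OF u(1)])
    then obtain w b where w: "w \<in> P ?n" "rev_incl w u" and b: "b \<in> P (Suc m)" "rev_incl b v"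
      and wb: "forces ?n w (\<lambda>\<xi>. a \<xi> = b)"
      by blast
    have wb: "forces ?n w (\<lambda>\<xi>. b \<in> D (s \<xi>))"
      by (rule forces_weaken[OF wb w(1)]) (use a(1) in auto)
    have "dom w \<subseteq> K ?n" "|dom w| \<le>o |K (Suc m)|"
      using w(1) Col_Suc_iff by blast+
    then obtain \<delta> where \<delta>: "\<delta> \<in> K ?n" "dom w \<subseteq> below ?n \<delta>"
      using ex_bound by blast
    define fill where "fill b = (\<lambda>\<gamma>. if \<gamma> \<in> below ?n \<delta> then Some (case w \<gamma> of None \<Rightarrow> c None | Some v \<Rightarrow> v)
        else if \<gamma> = \<delta> then Some b else None)" for b
    \<comment> \<open>The good members below \<open>\<delta>\<close> do not depend on the value that will be chosen at \<open>\<delta>\<close>.\<close>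
    define L where "L = {q. \<exists>\<gamma>\<in>below ?n \<delta>. good m (seq (fill (c None))) \<gamma> \<and> seq (fill (c None)) \<gamma> = Some q}"
    have L_sub: "L \<subseteq> good_values m (seq (fill (c None)))"
      unfolding L_def good_values_def using below_subset by blast
    have "L \<subseteq> (\<lambda>\<gamma>. the (seq (fill (c None)) \<gamma>)) ` below ?n \<delta>"
      unfolding L_def by force
    then have "|L| \<le>o |K (Suc m)|"
      using subset_ordLeq_K image_ordLeq_K below_Suc_ordLeq[OF \<delta>(1)] by blast
    then obtain p where p: "p \<in> Q m" "\<And>l. l \<in> L \<Longrightarrow> le_ae m p l"
      using le_ae_lower_bound[of L m] L_sub good_values_Q good_values_chain by (meson subset_trans subsetD)
    let ?r = "fill (c (Some p))"
    have r: "?r \<in> P ?n" "rev_incl ?r w" "dom ?r = below ?n \<delta> \<union> {\<delta>}"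
      using Col_fill[OF w(1) \<delta>, of "c None" "c (Some p)" ?r] c_K p(1) fill_def by auto
    have seq_below: "seq ?r \<gamma> = seq (fill (c None)) \<gamma>" if "\<gamma> \<in> below ?n \<delta>" for \<gamma>
      using that by (simp add: seq_def fill_def)
    have good_below: "good m (seq ?r) \<gamma> = good m (seq (fill (c None))) \<gamma>" if "\<gamma> \<in> below ?n \<delta>" for \<gamma>
      using that below_trans by (intro good_cong seq_below) blast
    have "seq ?r \<delta> = Some p"
      using p(1) by (simp add: seq_def fill_def below_irrefl decode)
    then have good: "good m (seq ?r) \<delta>"
      using p seq_below good_below unfolding good_iff[of m "seq ?r" \<delta>] L_def by auto
    have ru: "rev_incl ?r u"
      using rev_incl_trans r(2) w(2) by blast
    have "d (f z) \<in> below ?n \<delta>" if "z \<in> below (Suc m) x" for z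
    proof -
      have "rev_incl w (R (f z))"
        using rev_incl_trans w(2) u(2)[OF that] by blast
      then have "dom (R (f z)) \<subseteq> dom w"
        unfolding rev_incl_def by (rule map_le_implies_dom_le)
      then show ?thesis
        using z_R(4)[OF that] \<delta>(2) by blast
    qed
    moreover have "R (?r, \<delta>, b) = ?r" "d (?r, \<delta>, b) = \<delta>" "e (?r, \<delta>, b) = b"
      by (simp_all add: R_def d_def e_def)
    ultimately have "stage f x (?r, \<delta>, b)"
      unfolding stage_def
      using r \<delta>(1) good b(1) forces_mono[OF r(1) w(1) r(2) wb] rev_incl_trans[OF ru u(2)]
        rev_incl_trans[OF b(2) v(2)] by auto
    then show ?thesis by blast
  qed
  have "\<exists>f. \<forall>x. stage f x (f x)"
  proof (rule dependent_wf_choice[OF wf_om[of "Suc m"]])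
    fix f g :: "'a \<Rightarrow> ('a \<rightharpoonup> 'a) \<times> 'a \<times> ('a \<rightharpoonup> 'a)" and x y
    assume "\<And>z. (z, x) \<in> om (Suc m) - Id \<Longrightarrow> f z = g z"
    then have eq: "f z = g z" if "z \<in> below (Suc m) x" for z
      using that below_iff by blast
    have "chain_at f x = chain_at g x"
      unfolding chain_at_def using eq by simp
    then show "stage f x y = stage g x y"
      unfolding stage_def using eq by simp
  next
    fix x and f :: "'a \<Rightarrow> ('a \<rightharpoonup> 'a) \<times> 'a \<times> ('a \<rightharpoonup> 'a)"
    assume IH: "\<And>z. (z, x) \<in> om (Suc m) - Id \<Longrightarrow> stage f z (f z)"
    show "\<exists>y. stage f x y"
    proof (cases "x \<in> K (Suc m)")
      case True
      then show ?thesis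
        using extend IH below_iff by blast
    next
      case False
      then show ?thesis by (simp add: stage_def)
    qed
  qed
  then obtain f where f: "\<And>x. stage f x (f x)" by blast
  have fR: "R (f x) \<in> P ?n" "d (f x) \<in> K ?n" "dom (R (f x)) = below ?n (d (f x)) \<union> {d (f x)}"
    "good m (seq (R (f x))) (d (f x))" "e (f x) \<in> P (Suc m)"
    "forces ?n (R (f x)) (\<lambda>\<xi>. e (f x) \<in> D (s \<xi>))" if "x \<in> K (Suc m)" for x
    using f[of x] that unfolding stage_def by blast+
  have f_below: "rev_incl (R (f x)) (R (f z))" "d (f z) \<in> below ?n (d (f x))"
    if "x \<in> K (Suc m)" "z \<in> below (Suc m) x" for x z
    using f[of x] that unfolding stage_def by blast+
  have f_e: "rev_incl (e (f x)) (top (f z) x)"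
    if "x \<in> K (Suc m)" "chain_at f x" "z \<in> below (Suc m) x" for x z
    using f[of x] that unfolding stage_def by blast
  have lin: "comparable (R (f z)) (R (f z'))" if "z \<in> K (Suc m)" "z' \<in> K (Suc m)" for z z'
    using below_linear[OF that] f_below(1)[OF that(1)] f_below(1)[OF that(2)] by (elim disjE) auto
  have "\<exists>u\<in>P ?n. (\<forall>z\<in>K (Suc m). rev_incl u (R (f z))) \<and> dom u = (\<Union>z\<in>K (Suc m). dom (R (f z)))"
    by (rule Col_Union[OF card_of_mono1[OF order.refl] fR(1) lin])
  then obtain u where u: "u \<in> P ?n" "\<And>z. z \<in> K (Suc m) \<Longrightarrow> rev_incl u (R (f z))"
    "dom u = (\<Union>z\<in>K (Suc m). dom (R (f z)))"
    by blast
  define q where "q = restrict (\<lambda>x. e (f x)) (K (Suc m))"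
  have q: "q \<in> Q m"
    unfolding Q_def q_def using fR(5) by auto
  \<comment> \<open>Later conditions do not change what is good, so the members introduced in the stages descend.\<close>
  have top_chain: "le_ae m (top (f x)) (top (f z))" if x: "x \<in> K (Suc m)" and z: "z \<in> below (Suc m) x" for x z
  proof -
    have z': "z \<in> K (Suc m)" using z below_subset by blast
    have "seq (R (f x)) \<gamma> = seq (R (f z)) \<gamma>" if "\<gamma> \<in> below ?n (d (f z)) \<union> {d (f z)}" for \<gamma>
      using seq_mono[OF f_below(1)[OF x z]] that fR(3)[OF z'] by blast
    then have "good m (seq (R (f x))) (d (f z))" "seq (R (f x)) (d (f z)) = Some (top (f z))"
      using good_cong[of m "d (f z)" "seq (R (f x))" "seq (R (f z))"] fR(4)[OF z'] top(1)[OF fR(4)[OF z']]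
      by auto
    then show ?thesis
      by (rule good_le_ae[OF fR(4)[OF x] top(1)[OF fR(4)[OF x]] f_below(2)[OF x z]])
  qed
  have q_top: "le_ae m q (top (f x))" if "x \<in> K (Suc m)" for x
  proof (rule le_ae_diagonal[of m "\<lambda>x. top (f x)"])
    fix w w' assume "w \<in> K (Suc m)" "w' \<in> K (Suc m)"
    then show "le_ae m (top (f w)) (top (f w')) \<or> le_ae m (top (f w')) (top (f w))"
      using below_linear[of w "Suc m" w'] top_chain[of w w'] top_chain[of w' w] le_ae_refl by blast
  next
    fix x w assume "x \<in> K (Suc m)" "w \<in> below (Suc m) x"
      "\<forall>u\<in>below (Suc m) x. \<forall>v\<in>below (Suc m) x. comparable (top (f u) x) (top (f v) x)"
    then show "rev_incl (q x) (top (f w) x)"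
      using f_e unfolding chain_at_def q_def by auto
  qed (rule that)
  have "dom u \<subseteq> K ?n" "|dom u| \<le>o |K (Suc m)|"
    using u(1) Col_Suc_iff by blast+
  then obtain \<delta> where \<delta>: "\<delta> \<in> K ?n" "dom u \<subseteq> below ?n \<delta>"
    using ex_bound by blast
  define r where "r = (\<lambda>\<gamma>. if \<gamma> \<in> below ?n \<delta> then Some (case u \<gamma> of None \<Rightarrow> c None | Some v \<Rightarrow> v)
      else if \<gamma> = \<delta> then Some (c (Some q)) else None)"
  have r: "r \<in> P ?n" "rev_incl r u" "dom r = below ?n \<delta> \<union> {\<delta>}"
    using Col_fill[OF u(1) \<delta>, of "c None" "c (Some q)" r] c_K q r_def by auto
  have r_R: "rev_incl r (R (f x))" if "x \<in> K (Suc m)" for x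
    using rev_incl_trans[OF r(2) u(2)[OF that]] .
  have "forces ?n r (\<lambda>\<xi>. \<forall>x\<in>K (Suc m). e (f x) \<in> D (s \<xi>))"
    using K_mono[of "Suc m" ?n] forces_mono[OF r(1) fR(1) r_R fR(6)] by (intro forces_ball) auto
  then obtain \<xi> where \<xi>: "\<And>\<gamma>. \<gamma> \<in> dom r \<Longrightarrow> r \<gamma> = Some (h \<xi> \<gamma>)"
    "\<And>x. x \<in> K (Suc m) \<Longrightarrow> e (f x) \<in> D (s \<xi>)"
    using forces_ex[OF forces_conj[OF h[OF r(1)]] r(1)] by blast
  have s_seq: "s \<xi> \<gamma> = seq r \<gamma>" if "\<gamma> \<in> dom r" for \<gamma>
    using \<xi>(1)[OF that] by (simp add: s_def seq_def)
  \<comment> \<open>Every good member before \<open>\<delta>\<close> lies in the domain of some stage, hence above its last member.\<close>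
  have "le_ae m q q'" if \<gamma>: "\<gamma> \<in> below ?n \<delta>" "s \<xi> \<gamma> = Some q'" "good m (s \<xi>) \<gamma>" for \<gamma> q'
  proof -
    have "seq r \<gamma> = Some q'"
      using s_seq[of \<gamma>] \<gamma> r(3) by simp
    then have "\<gamma> \<in> dom u"
      using \<gamma>(1) decode[of None] by (auto simp: seq_def r_def split: option.splits)
    then obtain x where x: "x \<in> K (Suc m)" "\<gamma> \<in> dom (R (f x))"
      using u(3) by blast
    have same: "s \<xi> \<beta> = seq (R (f x)) \<beta>" if "\<beta> \<in> dom (R (f x))" for \<beta>
    proof -
      have "\<beta> \<in> dom r"
        using that map_le_implies_dom_le r_R[OF x(1)] unfolding rev_incl_def by blast
      then show ?thesis
        using s_seq seq_mono[OF r_R[OF x(1)] that] by simp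
    qed
    have "\<gamma> \<in> below ?n (d (f x)) \<or> \<gamma> = d (f x)"
      using x fR(3) by blast
    then show ?thesis
    proof
      assume less: "\<gamma> \<in> below ?n (d (f x))"
      have "good m (s \<xi>) \<gamma> = good m (seq (R (f x))) \<gamma>"
        using less below_trans fR(3)[OF x(1)] by (intro good_cong same) blast
      then have "le_ae m (top (f x)) q'"
        using good_le_ae[OF fR(4)[OF x(1)] top(1)[OF fR(4)[OF x(1)]] less] \<gamma> same[OF x(2)] by simp
      then show ?thesis
        using le_ae_trans q_top[OF x(1)] by blast
    next
      assume "\<gamma> = d (f x)"
      then have "q' = top (f x)"
        using same[OF x(2)] \<gamma>(2) top(1)[OF fR(4)[OF x(1)]] by simp
      then show ?thesis
        using q_top[OF x(1)] by simp
    qed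
  qed
  moreover have s_q: "s \<xi> \<delta> = Some q"
    using s_seq[of \<delta>] r(3) q by (simp add: seq_def r_def below_irrefl decode)
  ultimately have "good m (s \<xi>) \<delta>"
    using q unfolding good_iff[of m "s \<xi>" \<delta>] by auto
  then have "q \<in> good_values m (s \<xi>)"
    using \<delta>(1) s_q unfolding good_values_def by blast
  then show False
    using missed[of q "s \<xi>"] \<xi>(2) by (auto simp: q_def)
qed

end

section \<open>Ultrafilters and ultrapowers\<close>

text \<open>
  The sets that become null when finitely many members of \<open>F\<close> are required form a proper ideal; the
  complements of the members of a maximal ideal above it form an ultrafilter.
\<close>

lemma ultrafilter_exists:
  assumes I: "ideal_on S I" and F: "F \<subseteq> Pow S"
    and fip: "\<And>Y. finite Y \<Longrightarrow> Y \<subseteq> F \<Longrightarrow> S \<inter> \<Inter>Y \<notin> I"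
  shows "\<exists>U. ultrafilter_on S U \<and> F \<subseteq> U \<and> (\<forall>A\<in>I. S - A \<in> U)"
proof -
  have sub: "\<And>A B. A \<in> I \<Longrightarrow> B \<subseteq> A \<Longrightarrow> B \<in> I" and un: "\<And>A B. A \<in> I \<Longrightarrow> B \<in> I \<Longrightarrow> A \<union> B \<in> I"
    and emp: "{} \<in> I" and IS: "I \<subseteq> Pow S"
    using I by (auto simp: ideal_on_def)
  define J where "J = {A. A \<subseteq> S \<and> (\<exists>Y. finite Y \<and> Y \<subseteq> F \<and> A \<inter> \<Inter>Y \<in> I)}"
  have J: "ideal_on S J"
    unfolding ideal_on_def
  proof (intro conjI ballI allI impI)
    show "J \<subseteq> Pow S" by (auto simp: J_def)
    show "{} \<in> J" using emp by (auto simp: J_def)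
    show "S \<notin> J" using fip by (auto simp: J_def)
    fix A assume A: "A \<in> J"
    then obtain Y where Y: "A \<subseteq> S" "finite Y" "Y \<subseteq> F" "A \<inter> \<Inter>Y \<in> I" by (auto simp: J_def)
    show "B \<in> J" if "B \<subseteq> A" for B
    proof -
      have "B \<inter> \<Inter>Y \<in> I" using sub[OF Y(4)] that by blast
      then show ?thesis using Y that unfolding J_def by blast
    qed
    fix B assume "B \<in> J"
    then obtain Z where Z: "B \<subseteq> S" "finite Z" "Z \<subseteq> F" "B \<inter> \<Inter>Z \<in> I" by (auto simp: J_def)
    have "(A \<union> B) \<inter> \<Inter>(Y \<union> Z) \<in> I"
      by (rule sub[OF un[OF Y(4) Z(4)]]) auto
    moreover have "A \<union> B \<subseteq> S" "finite (Y \<union> Z)" "Y \<union> Z \<subseteq> F"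
      using Y Z by auto
    ultimately show "A \<union> B \<in> J"
      unfolding J_def by blast
  qed
  let ?A = "{M. ideal_on S M \<and> J \<subseteq> M}"
  have "\<exists>M\<in>?A. \<forall>X\<in>?A. M \<subseteq> X \<longrightarrow> X = M"
  proof (rule subset_Zorn_nonempty)
    show "?A \<noteq> {}" using J by blast
    fix C assume C: "C \<noteq> {}" "subset.chain ?A C"
    have ch: "M \<subseteq> N \<or> N \<subseteq> M" if "M \<in> C" "N \<in> C" for M N
      using C(2) that unfolding subset_chain_def by blast
    have id: "ideal_on S M" "J \<subseteq> M" if "M \<in> C" for M
      using C(2) that unfolding subset_chain_def by blast+
    have "ideal_on S (\<Union>C)"
      unfolding ideal_on_def
    proof (intro conjI ballI allI impI)
      show "\<Union>C \<subseteq> Pow S" "{} \<in> \<Union>C" "S \<notin> \<Union>C"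
        using id(1) C(1) unfolding ideal_on_def by blast+
      fix A assume "A \<in> \<Union>C"
      then obtain M where M: "M \<in> C" "A \<in> M" by blast
      show "B \<in> \<Union>C" if "B \<subseteq> A" for B
        using id(1)[OF M(1)] M that unfolding ideal_on_def by blast
      fix B assume "B \<in> \<Union>C"
      then obtain N where N: "N \<in> C" "B \<in> N" by blast
      obtain O' where "O' \<in> C" "A \<in> O'" "B \<in> O'"
        using ch[OF M(1) N(1)] M N by blast
      then show "A \<union> B \<in> \<Union>C"
        using id(1) unfolding ideal_on_def by blast
    qed
    then show "\<Union>C \<in> ?A"
      using id(2) C(1) by blast
  qed
  then obtain M where M: "ideal_on S M" "J \<subseteq> M"
    and max: "\<And>N. ideal_on S N \<Longrightarrow> M \<subseteq> N \<Longrightarrow> N = M" by auto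
  have Msub: "\<And>A B. A \<in> M \<Longrightarrow> B \<subseteq> A \<Longrightarrow> B \<in> M" and Mun: "\<And>A B. A \<in> M \<Longrightarrow> B \<in> M \<Longrightarrow> A \<union> B \<in> M"
    and Memp: "{} \<in> M" and MS: "M \<subseteq> Pow S" and MnS: "S \<notin> M"
    using M(1) by (auto simp: ideal_on_def)
  have ultra: "A \<in> M \<or> S - A \<in> M" if A: "A \<subseteq> S" for A
  proof (rule ccontr)
    assume *: "\<not> ?thesis"
    let ?N = "{B. B \<subseteq> S \<and> B - A \<in> M}"
    have "ideal_on S ?N"
      unfolding ideal_on_def
    proof (intro conjI ballI allI impI)
      show "?N \<subseteq> Pow S" "{} \<in> ?N" "S \<notin> ?N"
        using Memp * by auto
      fix B assume B: "B \<in> ?N"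
      show "C \<in> ?N" if "C \<subseteq> B" for C
        using B that Msub[of "B - A" "C - A"] by auto
      fix C assume C: "C \<in> ?N"
      then show "B \<union> C \<in> ?N"
        using B Mun[of "B - A" "C - A"] by (auto simp: Un_Diff)
    qed
    moreover have "M \<subseteq> ?N"
      using MS Msub by blast
    moreover have "A \<in> ?N"
      using A Memp by simp
    ultimately show False
      using max * by blast
  qed
  define U where "U = {A. A \<subseteq> S \<and> S - A \<in> M}"
  have "ultrafilter_on S U"
    unfolding ultrafilter_on_def
  proof (intro conjI ballI allI impI)
    show "U \<subseteq> Pow S" "S \<in> U" "{} \<notin> U"
      using Memp MnS by (auto simp: U_def)
    fix A assume A: "A \<in> U"
    show "B \<in> U" if "A \<subseteq> B \<and> B \<subseteq> S" for B
      using A that Msub[of "S - A" "S - B"] by (auto simp: U_def)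
    fix B assume "B \<in> U"
    then show "A \<inter> B \<in> U"
      using A Mun[of "S - A" "S - B"] by (auto simp: U_def Diff_Int)
  next
    fix A assume "A \<subseteq> S"
    then show "A \<in> U \<or> S - A \<in> U"
      using ultra[of A] by (auto simp: U_def double_diff)
  qed
  moreover have "F \<subseteq> U"
  proof
    fix Y assume Y: "Y \<in> F"
    have "(S - Y) \<inter> \<Inter>{Y} = {}" by auto
    then have "(S - Y) \<inter> \<Inter>{Y} \<in> I" using emp by simp
    then have "S - Y \<in> J"
      using Y unfolding J_def by blast
    then show "Y \<in> U"
      using M(2) Y F by (auto simp: U_def)
  qed
  moreover have "S - A \<in> U" if "A \<in> I" for A
  proof -
    have "A \<inter> \<Inter>{} \<in> I" using that by simp
    then have "A \<in> J"
      using IS that unfolding J_def by blast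
    moreover have "S - (S - A) = A"
      using IS that by blast
    ultimately show ?thesis
      using M(2) by (auto simp: U_def)
  qed
  ultimately show ?thesis by blast
qed

lemma ultrafilter_on_D:
  assumes "ultrafilter_on S U"
  shows "\<And>A. A \<in> U \<Longrightarrow> A \<subseteq> S" and "S \<in> U" and "{} \<notin> U"
    and "\<And>A B. A \<in> U \<Longrightarrow> A \<subseteq> B \<Longrightarrow> B \<subseteq> S \<Longrightarrow> B \<in> U"
    and "\<And>A B. A \<in> U \<Longrightarrow> B \<in> U \<Longrightarrow> A \<inter> B \<in> U"
    and "\<And>A. A \<subseteq> S \<Longrightarrow> A \<in> U \<or> S - A \<in> U"
  using assms unfolding ultrafilter_on_def by blast+

lemma equiv_ultrapower:
  assumes U: "ultrafilter_on S U"
  shows "equiv (S \<rightarrow>\<^sub>E B) {(f, g). f \<in> S \<rightarrow>\<^sub>E B \<and> g \<in> S \<rightarrow>\<^sub>E B \<and> {x \<in> S. f x = g x} \<in> U}"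
    (is "equiv ?F ?r")
proof (rule equivI)
  show "?r \<subseteq> ?F \<times> ?F" by auto
  show "refl_on ?F ?r"
    using ultrafilter_on_D(2)[OF U] by (auto simp: refl_on_def)
  show "sym ?r"
  proof (rule symI)
    fix f g assume "(f, g) \<in> ?r"
    moreover have "{x \<in> S. g x = f x} = {x \<in> S. f x = g x}" by auto
    ultimately show "(g, f) \<in> ?r" by simp
  qed
  show "trans ?r"
  proof (rule transI)
    fix f g h assume fg: "(f, g) \<in> ?r" "(g, h) \<in> ?r"
    then have "{x \<in> S. f x = g x} \<inter> {x \<in> S. g x = h x} \<in> U"
      using ultrafilter_on_D(5)[OF U] by blast
    then have "{x \<in> S. f x = h x} \<in> U"
      by (rule ultrafilter_on_D(4)[OF U]) auto
    then show "(f, h) \<in> ?r"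
      using fg by simp
  qed
qed

lemma ultrapower_ordLeq:
  assumes U: "ultrafilter_on S U" and T: "\<phi> ` (S \<rightarrow>\<^sub>E B) \<subseteq> T"
    and \<phi>: "\<And>f g. \<lbrakk>f \<in> S \<rightarrow>\<^sub>E B; g \<in> S \<rightarrow>\<^sub>E B; \<phi> f = \<phi> g\<rbrakk> \<Longrightarrow> {x \<in> S. f x = g x} \<in> U"
  shows "|ultrapower B S U| \<le>o |T|"
proof -
  let ?r = "{(f, g). f \<in> S \<rightarrow>\<^sub>E B \<and> g \<in> S \<rightarrow>\<^sub>E B \<and> {x \<in> S. f x = g x} \<in> U}"
  note eq = equiv_ultrapower[OF U, of B]
  let ?rep = "\<lambda>c. SOME f. f \<in> c"
  have rep: "?rep c \<in> c" "?rep c \<in> S \<rightarrow>\<^sub>E B" if c: "c \<in> ultrapower B S U" for c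
  proof -
    have "c \<noteq> {}" "c \<subseteq> S \<rightarrow>\<^sub>E B"
      using c in_quotient_imp_non_empty[OF eq] in_quotient_imp_subset[OF eq]
      unfolding ultrapower_def by blast+
    then show "?rep c \<in> c" "?rep c \<in> S \<rightarrow>\<^sub>E B"
      using some_in_eq[of c] by blast+
  qed
  have "inj_on (\<lambda>c. \<phi> (?rep c)) (ultrapower B S U)"
  proof (rule inj_onI)
    fix c d assume c: "c \<in> ultrapower B S U" and d: "d \<in> ultrapower B S U" and e: "\<phi> (?rep c) = \<phi> (?rep d)"
    have "(?rep c, ?rep d) \<in> ?r"
      using \<phi>[OF rep(2)[OF c] rep(2)[OF d] e] rep(2)[OF c] rep(2)[OF d] by simp
    then show "c = d"
      using quotient_eqI[OF eq _ _ rep(1)[OF c] rep(1)[OF d]] c d unfolding ultrapower_def by simp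
  qed
  moreover have "(\<lambda>c. \<phi> (?rep c)) ` ultrapower B S U \<subseteq> T"
    using rep(2) T by blast
  ultimately show ?thesis
    using card_of_ordLeq by blast
qed

lemma ordLeq_ultrapower:
  assumes U: "ultrafilter_on S U" and \<psi>: "\<psi> ` T \<subseteq> S \<rightarrow>\<^sub>E B"
    and neq: "\<And>s t. \<lbrakk>s \<in> T; t \<in> T; s \<noteq> t\<rbrakk> \<Longrightarrow> {x \<in> S. \<psi> s x = \<psi> t x} \<notin> U"
  shows "|T| \<le>o |ultrapower B S U|"
proof -
  let ?r = "{(f, g). f \<in> S \<rightarrow>\<^sub>E B \<and> g \<in> S \<rightarrow>\<^sub>E B \<and> {x \<in> S. f x = g x} \<in> U}"
  note eq = equiv_ultrapower[OF U, of B]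
  have "inj_on (\<lambda>t. ?r `` {\<psi> t}) T"
  proof (rule inj_onI)
    fix s t assume st: "s \<in> T" "t \<in> T" "?r `` {\<psi> s} = ?r `` {\<psi> t}"
    then have "(\<psi> s, \<psi> t) \<in> ?r"
      using eq_equiv_class_iff[OF eq, of "\<psi> s" "\<psi> t"] \<psi> by blast
    then show "s = t"
      using neq st by blast
  qed
  moreover have "(\<lambda>t. ?r `` {\<psi> t}) ` T \<subseteq> ultrapower B S U"
    unfolding ultrapower_def using \<psi> by (intro image_subsetI quotientI) blast
  ultimately show ?thesis
    using card_of_ordLeq by blast
qed

lemma card_of_finite_subsets:
  assumes inf: "infinite L"
  shows "|{A. A \<subseteq> L \<and> finite A}| \<le>o |L|"
proof -
  define T where "T n = {A. A \<subseteq> L \<and> finite A \<and> card A \<le> n}" for n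
  obtain x0 where x0: "x0 \<in> L" using inf by fastforce
  have single: "|{B}| \<le>o |L|" for B :: "'a set"
    using card_of_singl_ordLeq[of L B] inf by blast
  have T: "|T n| \<le>o |L|" for n
  proof (induction n)
    case 0
    have "T 0 = {{}}" by (auto simp: T_def)
    then show ?case using single by simp
  next
    case (Suc n)
    have "T (Suc n) \<subseteq> (\<Union>A\<in>T n. (\<lambda>x. insert x A) ` L) \<union> {{}}"
    proof
      fix A assume A: "A \<in> T (Suc n)"
      show "A \<in> (\<Union>A\<in>T n. (\<lambda>x. insert x A) ` L) \<union> {{}}"
      proof (cases "A = {}")
        case False
        then obtain x where x: "x \<in> A" by blast
        then have "A - {x} \<in> T n" "A = insert x (A - {x})" "x \<in> L"
          using A by (auto simp: T_def)
        then show ?thesis by blast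
      qed simp
    qed
    then have "|T (Suc n)| \<le>o |(\<Union>A\<in>T n. (\<lambda>x. insert x A) ` L) \<union> {{}}|"
      by (rule card_of_mono1)
    moreover have "|\<Union>A\<in>T n. (\<lambda>x. insert x A) ` L| \<le>o |L|"
      using Suc card_of_image by (intro card_of_UNION_ordLeq_infinite[OF inf]) blast+
    then have "|(\<Union>A\<in>T n. (\<lambda>x. insert x A) ` L) \<union> {{}}| \<le>o |L|"
      using card_of_Un_ordLeq_infinite_Field[of "|L|", OF _ _ single card_of_Card_order] inf
      by (simp add: Field_card_of)
    ultimately show ?case
      by (rule ordLeq_transitive)
  qed
  have "|\<Union>n. T n| \<le>o |L|"
    using T iffD1[OF infinite_iff_card_of_nat inf] by (intro card_of_UNION_ordLeq_infinite[OF inf]) auto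
  moreover have "|{A. A \<subseteq> L \<and> finite A}| \<le>o |\<Union>n. T n|"
    by (rule card_of_mono1) (auto simp: T_def)
  ultimately show ?thesis
    using ordLeq_transitive by blast
qed

text \<open>
  The ultrafilter is regular: \<open>s\<close> maps \<open>L\<close> onto the finite subsets of \<open>L\<close>, and each \<open>\<alpha>\<close> is in almost all
  of the values \<open>s x\<close>.
\<close>

lemma regular_ultrafilter_exists:
  assumes inf: "infinite L"
  shows "\<exists>V s. ultrafilter_on L V \<and> (\<forall>x. finite (s x)) \<and> (\<forall>\<alpha>\<in>L. {x \<in> L. \<alpha> \<in> s x} \<in> V)"
proof -
  have ne: "{A. A \<subseteq> L \<and> finite A} \<noteq> {}" by blast
  obtain s where s: "s ` L = {A. A \<subseteq> L \<and> finite A}"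
    using iffD2[OF card_of_ordLeq2[OF ne] card_of_finite_subsets[OF inf]] by (elim exE)
  let ?F = "(\<lambda>\<alpha>. {x \<in> L. \<alpha> \<in> s x}) ` L"
  have "L \<noteq> {}" using inf by auto
  then have I: "ideal_on L {{}}"
    by (auto simp: ideal_on_def)
  have "L \<inter> \<Inter>Y \<notin> {{}}" if Y: "finite Y" "Y \<subseteq> ?F" for Y
  proof -
    obtain A where A: "A \<subseteq> L" "finite A" "Y = (\<lambda>\<alpha>. {x \<in> L. \<alpha> \<in> s x}) ` A"
      using finite_subset_image[OF Y] by blast
    then have "A \<in> s ` L"
      using s by simp
    then obtain x where "x \<in> L" "s x = A" by blast
    then have "x \<in> L \<inter> \<Inter>Y"
      using A by auto
    then show ?thesis by auto
  qed
  then obtain V where V: "ultrafilter_on L V" "?F \<subseteq> V"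
    using ultrafilter_exists[OF I, of ?F] by auto
  let ?s = "\<lambda>x. if x \<in> L then s x else {}"
  have "finite (?s x)" for x
    using s by auto
  moreover have "{x \<in> L. \<alpha> \<in> ?s x} \<in> V" if "\<alpha> \<in> L" for \<alpha>
  proof -
    have "{x \<in> L. \<alpha> \<in> ?s x} = {x \<in> L. \<alpha> \<in> s x}" by auto
    then show ?thesis using V(2) that by auto
  qed
  ultimately show ?thesis
    using V(1) by (intro exI[of _ V] exI[of _ ?s] conjI allI ballI)
qed

lemma uniform_ultrafilter_exists:
  assumes inf: "infinite S"
  shows "\<exists>U. uniform_ultrafilter_on S U"
proof -
  let ?I = "{A. A \<subseteq> S \<and> |A| <o |S|}"
  have I: "ideal_on S ?I"
    unfolding ideal_on_def
  proof (intro conjI ballI allI impI)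
    show "{} \<in> ?I"
      using inf finite_ordLess_infinite[OF card_of_Well_order card_of_Well_order]
      by (metis (no_types, lifting) Field_card_of empty_subsetI finite.emptyI mem_Collect_eq)
    show "S \<notin> ?I"
      using ordLess_irreflexive by blast
    show "B \<in> ?I" if "A \<in> ?I" "B \<subseteq> A" for A B
      using that card_of_mono1 ordLeq_ordLess_trans by blast
    show "A \<union> B \<in> ?I" if "A \<in> ?I" "B \<in> ?I" for A B
      using that card_of_Un_ordLess_infinite[OF inf, of A B] by simp
  qed auto
  have "S \<inter> \<Inter>Y \<notin> ?I" if "Y \<subseteq> {}" for Y
    using that ordLess_irreflexive by auto
  then obtain U where U: "ultrafilter_on S U" "\<And>A. A \<in> ?I \<Longrightarrow> S - A \<in> U"
    using ultrafilter_exists[OF I, of "{}"] by auto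
  have "|A| =o |S|" if A: "A \<in> U" for A
  proof -
    have AS: "A \<subseteq> S" using ultrafilter_on_D(1)[OF U(1) A] .
    have "\<not> |A| <o |S|"
    proof
      assume "|A| <o |S|"
      then have "A \<inter> (S - A) \<in> U"
        using U(2) AS A ultrafilter_on_D(5)[OF U(1)] by blast
      then show False
        using ultrafilter_on_D(3)[OF U(1)] by simp
    qed
    then have "|S| \<le>o |A|"
      using ordLess_or_ordLeq[OF card_of_Well_order card_of_Well_order] by blast
    then show ?thesis
      using card_of_mono1[OF AS] ordIso_iff_ordLeq by blast
  qed
  then show ?thesis
    using U(1) unfolding uniform_ultrafilter_on_def by blast
qed

text \<open>
  \<open>W\<close> is the image of the product of a regular ultrafilter \<open>V\<close> and \<open>U\<close> under a bijection of \<open>L \<times> Y\<close>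
  and \<open>Y\<close>. A subset \<open>G\<close> of \<open>L\<close> is mapped to the function that takes \<open>(x, y)\<close> to a code of the finite set
  \<open>G \<inter> s x\<close>. Two such functions differ at almost all points, namely where \<open>s x\<close> contains a given element
  of the symmetric difference. On the other hand, a function on the product is determined by the
  classes of its sections.
\<close>

lemma regular_product:
  assumes inf: "infinite L" and le: "|L| \<le>o |Y|" and B: "infinite B"
    and U: "uniform_ultrafilter_on Y U"
  shows "\<exists>W. uniform_ultrafilter_on Y W \<and> |Pow L| \<le>o |ultrapower B Y W| \<and>
           |ultrapower B Y W| \<le>o |L \<rightarrow>\<^sub>E ultrapower B Y U|"
proof -
  have infY: "infinite Y" and LY: "L \<noteq> {}"
    using inf le card_of_ordLeq_infinite by auto
  have U': "ultrafilter_on Y U" and Usize: "\<And>A. A \<in> U \<Longrightarrow> |A| =o |Y|"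
    using U by (auto simp: uniform_ultrafilter_on_def)
  obtain V s where V: "ultrafilter_on L V" and s: "\<And>x. finite (s x)"
    and reg: "\<And>\<alpha>. \<alpha> \<in> L \<Longrightarrow> {x \<in> L. \<alpha> \<in> s x} \<in> V"
    using regular_ultrafilter_exists[OF inf] by blast
  have "|L \<times> Y| =o |Y|"
    by (rule card_of_Times_infinite_simps(3)[OF infY LY le])
  then obtain j where j: "bij_betw j (L \<times> Y) Y"
    using card_of_ordIso by metis
  have jY: "j (x, y) \<in> Y" if "x \<in> L" "y \<in> Y" for x y
    using bij_betw_imp_surj_on[OF j] that by blast
  define slice where "slice A x = {y \<in> Y. j (x, y) \<in> A}" for A x
  have slice_Int: "slice (A \<inter> A') x = slice A x \<inter> slice A' x" for A A' x
    by (auto simp: slice_def)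
  have slice_sub: "slice A x \<subseteq> Y" for A x
    by (auto simp: slice_def)
  have slice_compl: "slice (Y - A) x = Y - slice A x" if "x \<in> L" for A x
    using jY[OF that] by (auto simp: slice_def)
  have compl: "Y - A \<in> U" if "A \<subseteq> Y" "A \<notin> U" for A
    using ultrafilter_on_D(6)[OF U'] that by blast
  define W where "W = {A. A \<subseteq> Y \<and> {x \<in> L. slice A x \<in> U} \<in> V}"
  have W: "ultrafilter_on Y W"
    unfolding ultrafilter_on_def
  proof (intro conjI ballI allI impI)
    show "W \<subseteq> Pow Y" by (auto simp: W_def)
    have "slice Y x = Y" if "x \<in> L" for x
      using jY[OF that] by (auto simp: slice_def)
    then have "{x \<in> L. slice Y x \<in> U} = L"
      using ultrafilter_on_D(2)[OF U'] by auto
    then show "Y \<in> W"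
      using ultrafilter_on_D(2)[OF V] by (simp add: W_def)
    have "{x \<in> L. slice {} x \<in> U} = {}"
      using ultrafilter_on_D(3)[OF U'] by (simp add: slice_def)
    then have "{x \<in> L. slice {} x \<in> U} \<notin> V"
      using ultrafilter_on_D(3)[OF V] by (simp only: not_False_eq_True)
    then show "{} \<notin> W"
      by (simp add: W_def)
    fix A assume A: "A \<in> W"
    show "A' \<in> W" if "A \<subseteq> A' \<and> A' \<subseteq> Y" for A'
    proof -
      have "slice A' x \<in> U" if "slice A x \<in> U" for x
        by (rule ultrafilter_on_D(4)[OF U' that _ slice_sub]) (use \<open>A \<subseteq> A' \<and> A' \<subseteq> Y\<close> in \<open>auto simp: slice_def\<close>)
      then have "{x \<in> L. slice A x \<in> U} \<subseteq> {x \<in> L. slice A' x \<in> U}" by blast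
      then show ?thesis
        using ultrafilter_on_D(4)[OF V, of "{x \<in> L. slice A x \<in> U}"] A that by (auto simp: W_def)
    qed
    fix A' assume A': "A' \<in> W"
    have "{x \<in> L. slice A x \<in> U} \<inter> {x \<in> L. slice A' x \<in> U} \<subseteq> {x \<in> L. slice (A \<inter> A') x \<in> U}"
      using ultrafilter_on_D(5)[OF U'] by (auto simp: slice_Int)
    then have "{x \<in> L. slice (A \<inter> A') x \<in> U} \<in> V"
      by (rule ultrafilter_on_D(4)[OF V ultrafilter_on_D(5)[OF V], rotated 2]) (use A A' in \<open>auto simp: W_def\<close>)
    then show "A \<inter> A' \<in> W"
      using A by (auto simp: W_def)
  next
    fix A assume A: "A \<subseteq> Y"
    have "L - {x \<in> L. slice A x \<in> U} \<subseteq> {x \<in> L. slice (Y - A) x \<in> U}"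
      using slice_compl compl[OF slice_sub] by auto
    then show "A \<in> W \<or> Y - A \<in> W"
      using ultrafilter_on_D(6)[OF V, of "{x \<in> L. slice A x \<in> U}"] A
        ultrafilter_on_D(4)[OF V, of "L - {x \<in> L. slice A x \<in> U}" "{x \<in> L. slice (Y - A) x \<in> U}"]
      by (auto simp: W_def)
  qed
  have "|A| =o |Y|" if A: "A \<in> W" for A
  proof -
    have "{x \<in> L. slice A x \<in> U} \<noteq> {}"
    proof
      assume "{x \<in> L. slice A x \<in> U} = {}"
      then have "{} \<in> V"
        using A by (simp only: W_def mem_Collect_eq)
      then show False
        using ultrafilter_on_D(3)[OF V] by simp
    qed
    then obtain x where x: "x \<in> L" "slice A x \<in> U" by blast
    have "inj_on (\<lambda>y. j (x, y)) (slice A x)"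
      using inj_onD[OF bij_betw_imp_inj_on[OF j]] x(1) slice_sub[of A x]
      by (intro inj_onI) blast
    moreover have "(\<lambda>y. j (x, y)) ` slice A x \<subseteq> A"
      by (auto simp: slice_def)
    ultimately have "|slice A x| \<le>o |A|"
      using card_of_ordLeq by blast
    then have "|Y| \<le>o |A|"
      using Usize[OF x(2)] ordIso_symmetric ordIso_ordLeq_trans by blast
    moreover have "A \<subseteq> Y" using A by (simp add: W_def)
    ultimately show ?thesis
      using card_of_mono1 ordIso_iff_ordLeq by blast
  qed
  then have "uniform_ultrafilter_on Y W"
    using W by (auto simp: uniform_ultrafilter_on_def)
  moreover have "|Pow L| \<le>o |ultrapower B Y W|"
  proof -
    obtain b :: "nat \<Rightarrow> 'c" where b: "inj b" "range b \<subseteq> B"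
      using infinite_countable_subset[OF B] by blast
    have "\<exists>g :: 'a set \<Rightarrow> nat. inj_on g (Pow (s x))" for x
      using finite_imp_inj_to_nat_seg[of "Pow (s x)"] s by auto
    then obtain code :: "'a \<Rightarrow> 'a set \<Rightarrow> nat" where code: "\<And>x. inj_on (code x) (Pow (s x))"
      by metis
    define fs where "fs = (\<lambda>z. fst (inv_into (L \<times> Y) j z))"
    have fs: "fs (j (x, y)) = x" if "x \<in> L" "y \<in> Y" for x y
      using inv_into_f_f[OF bij_betw_imp_inj_on[OF j]] that by (simp add: fs_def)
    define \<psi> where "\<psi> G = restrict (\<lambda>z. b (code (fs z) (G \<inter> s (fs z)))) Y" for G
    show ?thesis
    proof (rule ordLeq_ultrapower[OF W, of \<psi>])
      show "\<psi> ` Pow L \<subseteq> Y \<rightarrow>\<^sub>E B"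
        using b(2) by (auto simp: \<psi>_def)
      fix G G' assume G: "G \<in> Pow L" "G' \<in> Pow L" "G \<noteq> G'"
      obtain \<alpha> where \<alpha>: "\<alpha> \<in> L" "\<alpha> \<in> G \<longleftrightarrow> \<alpha> \<notin> G'"
        using G by blast
      show "{z \<in> Y. \<psi> G z = \<psi> G' z} \<notin> W" (is "?E \<notin> W")
      proof
        assume "?E \<in> W"
        then have "{x \<in> L. slice ?E x \<in> U} \<inter> {x \<in> L. \<alpha> \<in> s x} \<in> V"
          using reg[OF \<alpha>(1)] ultrafilter_on_D(5)[OF V] by (auto simp: W_def)
        then have "{x \<in> L. slice ?E x \<in> U} \<inter> {x \<in> L. \<alpha> \<in> s x} \<noteq> {}"
          using ultrafilter_on_D(3)[OF V] by force
        then obtain x where x: "x \<in> L" "slice ?E x \<in> U" "\<alpha> \<in> s x" by blast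
        then obtain y where y: "y \<in> slice ?E x"
          using ultrafilter_on_D(3)[OF U'] by (metis ex_in_conv)
        have "y \<in> Y" "\<psi> G (j (x, y)) = \<psi> G' (j (x, y))"
          using y by (auto simp: slice_def)
        then have "code x (G \<inter> s x) = code x (G' \<inter> s x)"
          using jY[OF x(1)] fs[OF x(1)] b(1) by (auto simp: \<psi>_def inj_def)
        then have "G \<inter> s x = G' \<inter> s x"
          using code[of x] by (auto simp: inj_on_def)
        then show False
          using \<alpha>(2) x(3) by blast
      qed
    qed
  qed
  moreover have "|ultrapower B Y W| \<le>o |L \<rightarrow>\<^sub>E ultrapower B Y U|"
  proof -
    let ?r = "{(f, g). f \<in> Y \<rightarrow>\<^sub>E B \<and> g \<in> Y \<rightarrow>\<^sub>E B \<and> {x \<in> Y. f x = g x} \<in> U}"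
    note eq = equiv_ultrapower[OF U', of B]
    define part where "part f x = restrict (\<lambda>y. f (j (x, y))) Y" for f :: "'b \<Rightarrow> 'c" and x
    have part: "part f x \<in> Y \<rightarrow>\<^sub>E B" if "f \<in> Y \<rightarrow>\<^sub>E B" "x \<in> L" for f x
      using that jY by (auto simp: part_def)
    let ?\<phi> = "\<lambda>f. restrict (\<lambda>x. ?r `` {part f x}) L"
    show ?thesis
    proof (rule ultrapower_ordLeq[OF W, of ?\<phi>])
      show "?\<phi> ` (Y \<rightarrow>\<^sub>E B) \<subseteq> L \<rightarrow>\<^sub>E ultrapower B Y U"
      proof (intro image_subsetI restrict_PiE_iff[THEN iffD2] ballI)
        fix f x assume "f \<in> Y \<rightarrow>\<^sub>E B" "x \<in> L"
        then show "?r `` {part f x} \<in> ultrapower B Y U"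
          unfolding ultrapower_def by (intro quotientI part)
      qed
      fix f g assume fg: "f \<in> Y \<rightarrow>\<^sub>E B" "g \<in> Y \<rightarrow>\<^sub>E B" "?\<phi> f = ?\<phi> g"
      have "slice {z \<in> Y. f z = g z} x \<in> U" if x: "x \<in> L" for x
      proof -
        have "?r `` {part f x} = ?r `` {part g x}"
          using fun_cong[OF fg(3), of x] x by simp
        then have "(part f x, part g x) \<in> ?r"
          using eq_equiv_class_iff[OF eq] part fg x by blast
        moreover have "{y \<in> Y. part f x y = part g x y} = slice {z \<in> Y. f z = g z} x"
          using jY[OF x] by (auto simp: part_def slice_def)
        ultimately show ?thesis by simp
      qed
      then have "{x \<in> L. slice {z \<in> Y. f z = g z} x \<in> U} = L" by blast
      then show "{z \<in> Y. f z = g z} \<in> W"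
        using ultrafilter_on_D(2)[OF V] by (simp add: W_def)
    qed
  qed
  ultimately show ?thesis by blast
qed

section \<open>Small ultrapowers\<close>

context omega_sequence
begin

text \<open>
  A union of countably many initial segments suffices, since the closure condition is about single
  elements.
\<close>

lemma ex_closed_initial_segment:
  assumes z: "z \<in> K (Suc n)" and g: "\<And>\<beta>. \<beta> \<in> K (Suc n) \<Longrightarrow> g \<beta> \<in> K (Suc n)"
  shows "\<exists>W\<subseteq>K (Suc n). z \<in> W \<and> |W| \<le>o |K n| \<and> (\<forall>w\<in>W. below (Suc n) w \<subseteq> W) \<and> g ` W \<subseteq> W"
proof -
  have "\<exists>b'\<in>K (Suc n). insert b (g ` (below (Suc n) b)) \<subseteq> below (Suc n) b'" if b: "b \<in> K (Suc n)" for b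
  proof (rule ex_bound)
    show "insert b (g ` (below (Suc n) b)) \<subseteq> K (Suc n)"
      using b g below_subset by blast
    have "|{b} \<union> g ` (below (Suc n) b)| \<le>o |K n|"
      using b by (intro Un_ordLeq_K image_ordLeq_K below_Suc_ordLeq finite_ordLeq_K) auto
    then show "|insert b (g ` (below (Suc n) b))| \<le>o |K n|" by simp
  qed
  then obtain t where t: "\<And>b. b \<in> K (Suc n) \<Longrightarrow> t b \<in> K (Suc n)"
    "\<And>b. b \<in> K (Suc n) \<Longrightarrow> insert b (g ` (below (Suc n) b)) \<subseteq> below (Suc n) (t b)"
    by metis
  define a where "a k = (t ^^ k) z" for k
  have a: "a k \<in> K (Suc n)" for k
    by (induction k) (auto simp: a_def z t(1))
  have a_Suc: "insert (a k) (g ` (below (Suc n) (a k))) \<subseteq> below (Suc n) (a (Suc k))" for k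
    using t(2)[OF a[of k]] by (simp add: a_def)
  let ?W = "\<Union>k. below (Suc n) (a k)"
  have "?W \<subseteq> K (Suc n)"
    using below_subset by blast
  moreover have "z \<in> ?W"
  proof -
    have "a 0 = z" by (simp add: a_def)
    then show ?thesis
      using a_Suc[of 0] by blast
  qed
  moreover have "|?W| \<le>o |K n|"
    using iffD1[OF infinite_iff_card_of_nat infinite_K] by (intro UN_ordLeq_K below_Suc_ordLeq a)
  moreover have "\<forall>w\<in>?W. below (Suc n) w \<subseteq> ?W"
    using below_trans by blast
  moreover have "g ` ?W \<subseteq> ?W"
    using a_Suc by blast
  ultimately show ?thesis by blast
qed

lemma initial_segments_linear:
  assumes "W \<subseteq> K n" "W' \<subseteq> K n" "\<forall>w\<in>W. below n w \<subseteq> W" "\<forall>w\<in>W'. below n w \<subseteq> W'"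
  shows "W \<subseteq> W' \<or> W' \<subseteq> W"
proof (rule ccontr)
  assume "\<not> ?thesis"
  then obtain x y where "x \<in> W" "x \<notin> W'" "y \<in> W'" "y \<notin> W" by blast
  then show False
    using below_linear[of x n y] assms by blast
qed

end

lemma finite_chain_max:
  assumes "finite A" "A \<noteq> {}" "\<And>f g. f \<in> A \<Longrightarrow> g \<in> A \<Longrightarrow> W f \<subseteq> W g \<or> W g \<subseteq> W f"
  shows "\<exists>f\<in>A. \<forall>g\<in>A. W g \<subseteq> W f"
  using assms
proof (induction rule: finite_ne_induct)
  case (singleton x)
  then show ?case by simp
next
  case (insert x F)
  then obtain f where f: "f \<in> F" "\<forall>g\<in>F. W g \<subseteq> W f" by blast
  have "W f \<subseteq> W x \<or> W x \<subseteq> W f"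
    using insert.prems f(1) by blast
  then show ?case
    using f by blast
qed

context collapsing_ideals
begin

definition dual_to :: "'a set set \<Rightarrow> nat \<Rightarrow> bool" where
  "dual_to U n \<longleftrightarrow> ultrafilter_on (K (Suc n)) U \<and> (\<forall>A\<in>I n. K (Suc n) - A \<in> U)"

lemma dual_to_uniform:
  assumes U: "dual_to U n"
  shows "uniform_ultrafilter_on (K (Suc n)) U"
proof -
  have U': "ultrafilter_on (K (Suc n)) U"
    using U by (simp add: dual_to_def)
  have "|A| =o |K (Suc n)|" if A: "A \<in> U" for A
  proof -
    have AK: "A \<subseteq> K (Suc n)"
      using ultrafilter_on_D(1)[OF U' A] .
    have "\<not> |A| <o |K (Suc n)|"
    proof
      assume "|A| <o |K (Suc n)|"
      then have "A \<in> I n"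
        using I_small[OF AK] ordLess_K_Suc_iff by blast
      then have "K (Suc n) - A \<in> U"
        using U by (simp add: dual_to_def)
      then have "A \<inter> (K (Suc n) - A) \<in> U"
        by (rule ultrafilter_on_D(5)[OF U' A])
      then show False
        using ultrafilter_on_D(3)[OF U'] by simp
    qed
    then have "|K (Suc n)| \<le>o |A|"
      using ordLess_or_ordLeq[OF card_of_Well_order card_of_Well_order] by blast
    then show ?thesis
      using card_of_mono1[OF AK] ordIso_iff_ordLeq by blast
  qed
  then show ?thesis
    using U' by (simp add: uniform_ultrafilter_on_def)
qed

text \<open>
  For a function \<open>f\<close>, each condition \<open>p\<close> has an extension \<open>r f p\<close> that decides the value of \<open>f\<close> to be
  \<open>v f p\<close>. Let \<open>D f\<close> be a set of \<open>\<omega>\<^sub>n\<close> conditions that is closed under \<open>r f\<close>. The union \<open>Y f\<close> of the sets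
  that represent the conditions \<open>r f p\<close> with \<open>p\<close> in \<open>D f\<close> is in general not of measure one. But finitely
  many of these unions always have a positive intersection: as the sets \<open>D f\<close> are initial segments
  in an enumeration of all conditions, they are linearly ordered, and starting with the smallest one
  a condition can be extended into each of them in turn. So \<open>U\<close> can contain every \<open>Y f\<close>, and on
  \<open>Y f\<close> the function is determined by the pairs \<open>(r f p, v f p)\<close>. There are
  \<open>\<omega>\<^sub>n\<^sub>+\<^sub>1\<^bsup>\<omega>\<^sub>n\<^esup> = \<omega>\<^sub>n\<^sub>+\<^sub>1\<close> possible sets of \<open>\<omega>\<^sub>n\<close> such pairs.
\<close>

lemma small_ultrapower_base:
  "\<exists>U. dual_to U n \<and> |ultrapower (K n) (K (Suc n)) U| \<le>o |K (Suc n)|"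
proof -
  let ?S = "K (Suc n)"
  obtain c where c: "inj_on c (P n)" "c ` P n \<subseteq> ?S"
    using card_of_Col card_of_ordLeq by metis
  let ?F = "?S \<rightarrow>\<^sub>E K n"
  have "\<exists>q v. q \<in> P n \<and> rev_incl q p \<and> v \<in> K n \<and> forces n q (\<lambda>\<xi>. f \<xi> = v)"
    if "f \<in> ?F" "p \<in> P n" for f p
    using forces_decide[OF that(2) card_of_mono1[OF order.refl], of f] that(1) by (auto simp: PiE_iff)
  then obtain r v where rv: "\<And>f p. f \<in> ?F \<Longrightarrow> p \<in> P n \<Longrightarrow>
      r f p \<in> P n \<and> rev_incl (r f p) p \<and> v f p \<in> K n \<and> forces n (r f p) (\<lambda>\<xi>. f \<xi> = v f p)"
    by metis
  define closed where "closed f W \<longleftrightarrow> W \<subseteq> ?S \<and> c Map.empty \<in> W \<and> |W| \<le>o |K n| \<and>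
      (\<forall>w\<in>W. below (Suc n) w \<subseteq> W) \<and> (\<forall>p\<in>P n. c p \<in> W \<longrightarrow> c (r f p) \<in> W)" for f W
  have "\<exists>W. closed f W" if f: "f \<in> ?F" for f
  proof -
    let ?g = "\<lambda>\<beta>. if \<beta> \<in> c ` P n then c (r f (the_inv_into (P n) c \<beta>)) else \<beta>"
    have g: "?g (c p) = c (r f p)" if "p \<in> P n" for p
      using that the_inv_into_f_f[OF c(1) that] by simp
    have "?g \<beta> \<in> ?S" if "\<beta> \<in> ?S" for \<beta>
    proof (cases "\<beta> \<in> c ` P n")
      case True
      then obtain p where p: "p \<in> P n" "\<beta> = c p" by blast
      then have "?g \<beta> = c (r f p)"
        using g by simp
      then show ?thesis
        using rv[OF f p(1)] c(2) by auto
    qed (use that in simp)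
    moreover have "c Map.empty \<in> ?S"
      using empty_in_Col c(2) by blast
    ultimately have "\<exists>W\<subseteq>?S. c Map.empty \<in> W \<and> |W| \<le>o |K n| \<and>
        (\<forall>w\<in>W. below (Suc n) w \<subseteq> W) \<and> ?g ` W \<subseteq> W"
      by (intro ex_closed_initial_segment)
    then obtain W where W: "W \<subseteq> ?S" "c Map.empty \<in> W" "|W| \<le>o |K n|"
      "\<forall>w\<in>W. below (Suc n) w \<subseteq> W" "?g ` W \<subseteq> W"
      by (elim exE conjE)
    have "c (r f p) \<in> W" if "p \<in> P n" "c p \<in> W" for p
    proof -
      have "?g (c p) \<in> W"
        by (rule subsetD[OF W(5) imageI[OF that(2)]])
      then show ?thesis
        by (simp only: g[OF that(1)])
    qed
    then show ?thesis
      using W(1-4) by (intro exI[of _ W]) (simp add: closed_def)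
  qed
  then obtain W where closed: "\<And>f. f \<in> ?F \<Longrightarrow> closed f (W f)"
    by metis
  then have W: "\<And>f. f \<in> ?F \<Longrightarrow> W f \<subseteq> ?S" "\<And>f. f \<in> ?F \<Longrightarrow> c Map.empty \<in> W f"
    "\<And>f. f \<in> ?F \<Longrightarrow> |W f| \<le>o |K n|" "\<And>f. f \<in> ?F \<Longrightarrow> \<forall>w\<in>W f. below (Suc n) w \<subseteq> W f"
    "\<And>f p. f \<in> ?F \<Longrightarrow> p \<in> P n \<Longrightarrow> c p \<in> W f \<Longrightarrow> c (r f p) \<in> W f"
    unfolding closed_def by blast+
  define D where "D f = {p \<in> P n. c p \<in> W f}" for f
  have D_ne: "Map.empty \<in> D f" if "f \<in> ?F" for f
    using W(2)[OF that] empty_in_Col by (simp add: D_def)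
  have D_small: "|D f| \<le>o |K n|" if f: "f \<in> ?F" for f
  proof -
    have "inj_on c (D f)" "c ` D f \<subseteq> W f"
      using c(1) by (auto simp: D_def inj_on_def)
    then have "|D f| \<le>o |W f|"
      using card_of_ordLeq by blast
    then show ?thesis
      using W(3)[OF f] ordLeq_transitive by blast
  qed
  define Y where "Y f = (\<Union>p\<in>D f. X n (r f p))" for f
  \<comment> \<open>The second conjunct keeps \<open>p\<close> inside one of the sets \<open>D f\<close> and hence inside all larger ones.\<close>
  have common: "\<exists>p\<in>P n. (\<forall>f\<in>A. X n p - Y f \<in> I n) \<and> (A = {} \<or> (\<exists>f\<in>A. c p \<in> W f))"
    if "finite A" "A \<subseteq> ?F" for A
    using that
  proof (induction A rule: finite_psubset_induct)
    case (psubset A)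
    show ?case
    proof (cases "A = {}")
      case True
      then show ?thesis using empty_in_Col by blast
    next
      case False
      have "W f \<subseteq> W g \<or> W g \<subseteq> W f" if "f \<in> A" "g \<in> A" for f g
        using that psubset.prems by (intro initial_segments_linear[of _ "Suc n"] W) auto
      then obtain f where f: "f \<in> A" "\<And>g. g \<in> A \<Longrightarrow> W g \<subseteq> W f"
        using finite_chain_max[OF psubset.hyps False, of W] by blast
      have fF: "f \<in> ?F" using f(1) psubset.prems by blast
      obtain p where p: "p \<in> P n" "\<forall>g\<in>A - {f}. X n p - Y g \<in> I n"
        "A - {f} = {} \<or> (\<exists>g\<in>A - {f}. c p \<in> W g)"
        using psubset.IH[of "A - {f}"] f(1) psubset.prems by blast
      obtain p' where p': "p' \<in> P n" "\<forall>g\<in>A - {f}. X n p' - Y g \<in> I n" "c p' \<in> W f"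
      proof (cases "A - {f} = {}")
        case True
        show ?thesis
          by (rule that[OF empty_in_Col]) (use True W(2)[OF fF] in auto)
      next
        case False
        then show ?thesis
          using that[OF p(1,2)] p(3) f(2) by blast
      qed
      let ?q = "r f p'"
      have q: "?q \<in> P n" "rev_incl ?q p'"
        using rv[OF fF p'(1)] by auto
      have "X n ?q - Y g \<in> I n" if "g \<in> A" for g
      proof (cases "g = f")
        case True
        have "X n ?q - Y f = {}"
          using p' by (auto simp: Y_def D_def)
        then show ?thesis
          using True I_empty by (simp only:)
      next
        case False
        have "X n ?q - Y g \<subseteq> (X n ?q - X n p') \<union> (X n p' - Y g)" by blast
        then show ?thesis
          using I_subset[OF I_Un[OF X_mono[OF q(1) p'(1) q(2)]]] p'(2) False that by blast
      qed
      moreover have "c ?q \<in> W f"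
        using W(5)[OF fF p'(1,3)] .
      ultimately show ?thesis
        using q(1) f(1) by blast
    qed
  qed
  have "?S \<inter> \<Inter>Z \<notin> I n" if Z: "finite Z" "Z \<subseteq> Y ` ?F" for Z
  proof
    assume *: "?S \<inter> \<Inter>Z \<in> I n"
    obtain A where A: "A \<subseteq> ?F" "finite A" "Z = Y ` A"
      using finite_subset_image[OF Z] by blast
    then obtain p where p: "p \<in> P n" "\<forall>f\<in>A. X n p - Y f \<in> I n"
      using common[of A] by blast
    have "(\<Union>f\<in>A. X n p - Y f) \<in> I n"
      using p(2) by (intro I_UN finite_ordLeq_K A) blast
    moreover have "X n p \<subseteq> (\<Union>f\<in>A. X n p - Y f) \<union> (?S \<inter> \<Inter>Z)"
      using X_sub[OF p(1)] A(3) by auto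
    ultimately have "X n p \<in> I n"
      using I_subset[OF I_Un[OF _ *]] by blast
    then show False
      using X_positive[OF p(1)] by simp
  qed
  moreover have "Y ` ?F \<subseteq> Pow ?S"
  proof (intro image_subsetI PowI)
    fix f assume f: "f \<in> ?F"
    have "X n (r f p) \<subseteq> ?S" if "p \<in> D f" for p
      using rv[OF f] that by (intro X_sub) (auto simp: D_def)
    then show "Y f \<subseteq> ?S"
      unfolding Y_def by (rule UN_least)
  qed
  ultimately have "\<exists>U. ultrafilter_on ?S U \<and> Y ` ?F \<subseteq> U \<and> (\<forall>A\<in>I n. ?S - A \<in> U)"
    by (intro ultrafilter_exists ideal)
  then obtain U where U: "ultrafilter_on ?S U" "Y ` ?F \<subseteq> U" "\<forall>A\<in>I n. ?S - A \<in> U"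
    by blast
  \<comment> \<open>The set of pairs is enumerated in length \<open>\<omega>\<^sub>n\<close>, which makes the possible sets easy to count.\<close>
  let ?T = "K n \<rightarrow>\<^sub>E P n \<times> K n"
  have "\<exists>t\<in>?T. t ` K n = (\<lambda>p. (r f p, v f p)) ` D f" if f: "f \<in> ?F" for f
  proof -
    have ne: "(\<lambda>p. (r f p, v f p)) ` D f \<noteq> {}"
      using D_ne[OF f] by blast
    obtain t where t: "t ` K n = (\<lambda>p. (r f p, v f p)) ` D f"
      using iffD2[OF card_of_ordLeq2[OF ne] image_ordLeq_K[OF D_small[OF f]]] by (elim exE)
    have "t x \<in> P n \<times> K n" if "x \<in> K n" for x
    proof -
      have "t x \<in> (\<lambda>p. (r f p, v f p)) ` D f"
        using t that by blast
      then show ?thesis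
        using rv[OF f] by (auto simp: D_def)
    qed
    then have "restrict t (K n) \<in> ?T" by auto
    moreover have "restrict t (K n) ` K n = (\<lambda>p. (r f p, v f p)) ` D f"
      using t by simp
    ultimately show ?thesis by (intro bexI[of _ "restrict t (K n)"])
  qed
  then have "\<forall>f\<in>?F. \<exists>t. t \<in> ?T \<and> t ` K n = (\<lambda>p. (r f p, v f p)) ` D f"
    by blast
  then obtain t where "\<forall>f\<in>?F. t f \<in> ?T \<and> t f ` K n = (\<lambda>p. (r f p, v f p)) ` D f"
    by (rule exE[OF bchoice])
  then have t: "\<And>f. f \<in> ?F \<Longrightarrow> t f \<in> ?T"
    "\<And>f. f \<in> ?F \<Longrightarrow> t f ` K n = (\<lambda>p. (r f p, v f p)) ` D f"
    by blast+
  have "|ultrapower (K n) ?S U| \<le>o |?T|"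
  proof (rule ultrapower_ordLeq[OF U(1), of t])
    show "t ` ?F \<subseteq> ?T" using t(1) by blast
    fix f g assume f: "f \<in> ?F" and g: "g \<in> ?F" and eq: "t f = t g"
    define bad where "bad f = (\<Union>p\<in>D f. {\<xi> \<in> X n (r f p). f \<xi> \<noteq> v f p})" for f
    have bad: "bad f \<in> I n" if "f \<in> ?F" for f
      unfolding bad_def
      by (rule I_UN[OF D_small[OF that]]) (use rv[OF that] in \<open>auto simp: forces_def D_def\<close>)
    have "Y f \<inter> ((?S - bad f) \<inter> (?S - bad g)) \<in> U"
      using U(2,3) bad f g by (intro ultrafilter_on_D(5)[OF U(1)]) blast+
    moreover have "Y f \<inter> ((?S - bad f) \<inter> (?S - bad g)) \<subseteq> {x \<in> ?S. f x = g x}"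
    proof
      fix x assume x: "x \<in> Y f \<inter> ((?S - bad f) \<inter> (?S - bad g))"
      then obtain p where p: "p \<in> D f" "x \<in> X n (r f p)"
        by (auto simp: Y_def)
      have fx: "f x = v f p"
        using x p by (auto simp: bad_def)
      have "(r f p, v f p) \<in> (\<lambda>p. (r g p, v g p)) ` D g"
        using t(2)[OF f] t(2)[OF g] eq p(1) by force
      then obtain p' where p': "p' \<in> D g" "r f p = r g p'" "v f p = v g p'"
        by auto
      have "g x = v g p'"
        using x p' p(2) by (auto simp: bad_def)
      then show "x \<in> {x \<in> ?S. f x = g x}"
        using fx p'(3) x by auto
    qed
    ultimately show "{x \<in> ?S. f x = g x} \<in> U"
      by (rule ultrafilter_on_D(4)[OF U(1)]) auto
  qed
  moreover have "|?T| \<le>o |?S|"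
  proof (rule PiE_K_ordLeq)
    show "|P n \<times> K n| \<le>o |?S|"
      by (intro card_of_Sigma_ordLeq_infinite[OF infinite_K card_of_Col] ballI K_mono) simp
  qed
  ultimately show ?thesis
    using U(1,3) ordLeq_transitive unfolding dual_to_def by blast
qed

lemma dense_in_decides:
  assumes "|B| \<le>o |K n|" and "\<And>\<xi>. \<xi> \<in> K (Suc n) \<Longrightarrow> f \<xi> \<in> B"
  shows "dense_in {p \<in> P n. \<exists>v\<in>B. forces n p (\<lambda>\<xi>. f \<xi> = v)} n"
  unfolding dense_in_def using forces_decide[where V = B and f = f, OF _ assms] by blast

text \<open>
  The new ultrafilter is generated by the sets \<open>X (Suc m) (q x)\<close>, first modulo \<open>U\<close> in the variable \<open>x\<close>
  and then along the chain \<open>G\<close> of \<open>generic_chain\<close>. A function \<open>f\<close> into a small set \<open>B\<close> is decided by all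
  members of some \<open>q\<close> in \<open>G\<close>, with value \<open>g x\<close> at \<open>x\<close>, and the class of \<open>g\<close> modulo \<open>U\<close> determines the class
  of \<open>f\<close>.
\<close>

lemma small_ultrapower_step:
  assumes U: "dual_to U m"
  shows "\<exists>U'. dual_to U' (Suc m) \<and>
    (\<forall>B. |B| \<le>o |K (Suc m)| \<longrightarrow>
       |ultrapower B (K (Suc (Suc m))) U'| \<le>o |ultrapower B (K (Suc m)) U| )"
proof -
  let ?S = "K (Suc m)" and ?S' = "K (Suc (Suc m))" and ?n = "Suc m"
  have U': "ultrafilter_on ?S U" and dual: "\<And>A. A \<in> I m \<Longrightarrow> ?S - A \<in> U"
    using U by (auto simp: dual_to_def)
  note up = ultrafilter_on_D(4)[OF U'] and cap = ultrafilter_on_D(5)[OF U']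
  obtain G where G: "G \<subseteq> Q m" "\<And>q q'. q \<in> G \<Longrightarrow> q' \<in> G \<Longrightarrow> le_ae m q q' \<or> le_ae m q' q"
    and meets: "\<And>D. dense_in D ?n \<Longrightarrow> \<exists>q\<in>G. \<forall>x\<in>?S. q x \<in> D"
    using generic_chain[of m] by blast
  have qP: "q x \<in> P ?n" if "q \<in> G" "x \<in> ?S" for q x
    using Q_D that G(1) by blast
  obtain q0 where q0: "q0 \<in> G"
    using meets[of "P ?n"] unfolding dense_in_def using rev_incl_refl by blast
  \<comment> \<open>The set of those \<open>x\<close> for which \<open>q x\<close> forces the generic ordinal to be in \<open>A\<close>.\<close>
  define R where "R q A = {x \<in> ?S. X ?n (q x) - A \<in> I ?n}" for q A
  have R_sub: "R q A \<subseteq> ?S" for q A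
    by (auto simp: R_def)
  have R_le: "R q A \<in> U" if q: "q \<in> G" "q' \<in> G" "le_ae m q q'" and A: "R q' A \<in> U" for q q' A
  proof -
    have "R q' A \<inter> (?S - {x \<in> ?S. \<not> rev_incl (q x) (q' x)}) \<in> U"
      using A dual q(3) by (intro cap) (auto simp: le_ae_def)
    moreover have "R q' A \<inter> (?S - {x \<in> ?S. \<not> rev_incl (q x) (q' x)}) \<subseteq> R q A"
    proof
      fix x assume "x \<in> R q' A \<inter> (?S - {x \<in> ?S. \<not> rev_incl (q x) (q' x)})"
      then have x: "x \<in> ?S" "X ?n (q' x) - A \<in> I ?n" "rev_incl (q x) (q' x)"
        by (auto simp: R_def)
      have "X ?n (q x) - X ?n (q' x) \<in> I ?n"
        using X_mono qP q x by blast
      from I_subset[OF I_Un[OF this x(2)], of "X ?n (q x) - A"] show "x \<in> R q A"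
        using x(1) by (auto simp: R_def)
    qed
    ultimately show ?thesis
      using up R_sub by blast
  qed
  have common: "\<exists>q\<in>G. R q A \<in> U \<and> R q B \<in> U" if "q \<in> G" "q' \<in> G" "R q A \<in> U" "R q' B \<in> U" for q q' A B
    using G(2)[OF that(1,2)] R_le that by blast
  define U' where "U' = {A. A \<subseteq> ?S' \<and> (\<exists>q\<in>G. R q A \<in> U)}"
  have decided: "\<exists>q\<in>G. \<exists>g. (\<forall>x\<in>?S. g x \<in> B \<and> forces ?n (q x) (\<lambda>\<xi>. f \<xi> = g x))"
    if B: "|B| \<le>o |K ?n|" and f: "\<And>\<xi>. \<xi> \<in> ?S' \<Longrightarrow> f \<xi> \<in> B" for B :: "'b set" and f
  proof -
    obtain q where q: "q \<in> G" "\<forall>x\<in>?S. q x \<in> {p \<in> P ?n. \<exists>v\<in>B. forces ?n p (\<lambda>\<xi>. f \<xi> = v)}"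
      using meets[OF dense_in_decides[where f = f, OF B f]] by blast
    then have "\<forall>x\<in>?S. \<exists>v. v \<in> B \<and> forces ?n (q x) (\<lambda>\<xi>. f \<xi> = v)" by blast
    then show ?thesis
      using q(1) by metis
  qed
  have ultra: "ultrafilter_on ?S' U'"
    unfolding ultrafilter_on_def
  proof (intro conjI ballI allI impI)
    show "U' \<subseteq> Pow ?S'" by (auto simp: U'_def)
    have "R q ?S' = ?S" if "q \<in> G" for q
      using X_sub[OF qP[OF that]] I_empty unfolding R_def by (auto simp: Diff_eq_empty_iff[THEN iffD2])
    then show "?S' \<in> U'"
      using ultrafilter_on_D(2)[OF U'] q0 by (auto simp: U'_def)
    have "R q {} = {}" if "q \<in> G" for q
      using X_positive[OF qP[OF that]] unfolding R_def by auto
    then show "{} \<notin> U'"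
      using ultrafilter_on_D(3)[OF U'] by (auto simp: U'_def)
    fix A assume A: "A \<in> U'"
    then obtain q where q: "A \<subseteq> ?S'" "q \<in> G" "R q A \<in> U" by (auto simp: U'_def)
    show "A' \<in> U'" if "A \<subseteq> A' \<and> A' \<subseteq> ?S'" for A'
    proof -
      have "R q A \<subseteq> R q A'"
        unfolding R_def using that I_subset by blast
      then have "R q A' \<in> U"
        using up[OF q(3)] R_sub by blast
      then show ?thesis
        using q(2) that by (auto simp: U'_def)
    qed
    fix A' assume "A' \<in> U'"
    then obtain q' where q': "A' \<subseteq> ?S'" "q' \<in> G" "R q' A' \<in> U" by (auto simp: U'_def)
    obtain p where p: "p \<in> G" "R p A \<in> U" "R p A' \<in> U"
      using common[OF q(2) q'(2) q(3) q'(3)] by blast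
    have "R p A \<inter> R p A' \<subseteq> R p (A \<inter> A')"
      unfolding R_def using I_Un by (auto simp: Diff_Int)
    then have "R p (A \<inter> A') \<in> U"
      using up[OF cap[OF p(2,3)]] R_sub by blast
    then show "A \<inter> A' \<in> U'"
      using p(1) q(1) by (auto simp: U'_def)
  next
    fix A assume A: "A \<subseteq> ?S'"
    have "dense_in {p \<in> P ?n. \<exists>v\<in>UNIV. forces ?n p (\<lambda>\<xi>. (\<xi> \<in> A) = v)} ?n"
      by (rule dense_in_decides) (auto intro: finite_ordLeq_K)
    then obtain q where "q \<in> G" "\<forall>x\<in>?S. \<exists>v. forces ?n (q x) (\<lambda>\<xi>. (\<xi> \<in> A) = v)"
      using meets by blast
    then obtain g where q: "q \<in> G" "\<And>x. x \<in> ?S \<Longrightarrow> forces ?n (q x) (\<lambda>\<xi>. (\<xi> \<in> A) = g x)"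
      by metis
    have "x \<in> R q A" if x: "x \<in> ?S" "g x" for x
      using I_subset[OF q(2)[OF x(1), unfolded forces_def], of "X ?n (q x) - A"] x by (auto simp: R_def)
    moreover have "x \<in> R q (?S' - A)" if x: "x \<in> ?S" "\<not> g x" for x
      using I_subset[OF q(2)[OF x(1), unfolded forces_def], of "X ?n (q x) - (?S' - A)"] x
        X_sub[OF qP[OF q(1) x(1)]] by (auto simp: R_def)
    ultimately have "?S - R q A \<subseteq> R q (?S' - A)"
      by blast
    then have "R q A \<in> U \<or> R q (?S' - A) \<in> U"
      using ultrafilter_on_D(6)[OF U' R_sub] up R_sub by blast
    then show "A \<in> U' \<or> ?S' - A \<in> U'"
      using A q(1) by (auto simp: U'_def)
  qed
  have "?S' - A \<in> U'" if A: "A \<in> I ?n" for A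
  proof -
    have "X ?n (q0 x) - (?S' - A) \<in> I ?n" if "x \<in> ?S" for x
      by (rule I_subset[OF A]) (use X_sub[OF qP[OF q0 that]] in blast)
    then have "R q0 (?S' - A) = ?S"
      by (auto simp: R_def)
    then have "R q0 (?S' - A) \<in> U"
      using ultrafilter_on_D(2)[OF U'] by simp
    then show ?thesis
      using q0 by (auto simp: U'_def)
  qed
  then have "dual_to U' ?n"
    using ultra by (auto simp: dual_to_def)
  moreover have "|ultrapower B ?S' U'| \<le>o |ultrapower B ?S U|" if B: "|B| \<le>o |K ?n|" for B :: "'b set"
  proof -
    let ?r = "{(f, g). f \<in> ?S \<rightarrow>\<^sub>E B \<and> g \<in> ?S \<rightarrow>\<^sub>E B \<and> {x \<in> ?S. f x = g x} \<in> U}"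
    note eq = equiv_ultrapower[OF U', of B]
    have "\<exists>q\<in>G. \<exists>g\<in>?S \<rightarrow>\<^sub>E B. \<forall>x\<in>?S. forces ?n (q x) (\<lambda>\<xi>. f \<xi> = g x)" if f: "f \<in> ?S' \<rightarrow>\<^sub>E B" for f
    proof -
      obtain q g where q: "q \<in> G" "\<forall>x\<in>?S. g x \<in> B \<and> forces ?n (q x) (\<lambda>\<xi>. f \<xi> = g x)"
        using decided[OF B, of f] f by auto
      then have "restrict g ?S \<in> ?S \<rightarrow>\<^sub>E B" "\<forall>x\<in>?S. forces ?n (q x) (\<lambda>\<xi>. f \<xi> = restrict g ?S x)"
        by auto
      then show ?thesis
        using q(1) by blast
    qed
    then obtain q g where qg: "\<And>f. f \<in> ?S' \<rightarrow>\<^sub>E B \<Longrightarrow> q f \<in> G" "\<And>f. f \<in> ?S' \<rightarrow>\<^sub>E B \<Longrightarrow> g f \<in> ?S \<rightarrow>\<^sub>E B"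
      "\<And>f x. f \<in> ?S' \<rightarrow>\<^sub>E B \<Longrightarrow> x \<in> ?S \<Longrightarrow> forces ?n (q f x) (\<lambda>\<xi>. f \<xi> = g f x)"
      by metis
    show ?thesis
    proof (rule ultrapower_ordLeq[OF ultra, of "\<lambda>f. ?r `` {g f}"])
      show "(\<lambda>f. ?r `` {g f}) ` (?S' \<rightarrow>\<^sub>E B) \<subseteq> ultrapower B ?S U"
        unfolding ultrapower_def using qg(2) by (intro image_subsetI quotientI)
      have agree: "{\<xi> \<in> ?S'. f1 \<xi> = f2 \<xi>} \<in> U'"
        if f: "f1 \<in> ?S' \<rightarrow>\<^sub>E B" "f2 \<in> ?S' \<rightarrow>\<^sub>E B" and g: "{x \<in> ?S. g f1 x = g f2 x} \<in> U"
          and le: "le_ae m (q f1) (q f2)" for f1 f2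
      proof -
        let ?E = "{\<xi> \<in> ?S'. f1 \<xi> = f2 \<xi>}"
        have "{x \<in> ?S. g f1 x = g f2 x} \<inter> (?S - {x \<in> ?S. \<not> rev_incl (q f1 x) (q f2 x)}) \<in> U"
          using g dual le by (intro cap) (auto simp: le_ae_def)
        moreover have "{x \<in> ?S. g f1 x = g f2 x} \<inter> (?S - {x \<in> ?S. \<not> rev_incl (q f1 x) (q f2 x)}) \<subseteq> R (q f1) ?E"
        proof
          fix x assume "x \<in> {x \<in> ?S. g f1 x = g f2 x} \<inter> (?S - {x \<in> ?S. \<not> rev_incl (q f1 x) (q f2 x)})"
          then have x: "x \<in> ?S" "g f1 x = g f2 x" "rev_incl (q f1 x) (q f2 x)" by auto
          have P1: "q f1 x \<in> P ?n" and P2: "q f2 x \<in> P ?n"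
            using qP qg(1) f x(1) by blast+
          have "forces ?n (q f1 x) (\<lambda>\<xi>. f1 \<xi> = g f1 x \<and> f2 \<xi> = g f2 x)"
            by (rule forces_conj[OF qg(3)[OF f(1) x(1)] forces_mono[OF P1 P2 x(3) qg(3)[OF f(2) x(1)]]])
          then have "X ?n (q f1 x) - ?E \<in> I ?n"
            unfolding forces_def by (rule I_subset) (use X_sub[OF P1] x(2) in auto)
          then show "x \<in> R (q f1) ?E"
            using x(1) by (simp add: R_def)
        qed
        ultimately have "R (q f1) ?E \<in> U"
          using up R_sub by blast
        then show ?thesis
          using qg(1)[OF f(1)] by (auto simp: U'_def)
      qed
      fix f1 f2 assume f: "f1 \<in> ?S' \<rightarrow>\<^sub>E B" "f2 \<in> ?S' \<rightarrow>\<^sub>E B" and "?r `` {g f1} = ?r `` {g f2}"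
      then have "(g f1, g f2) \<in> ?r"
        using eq_equiv_class_iff[OF eq qg(2)[OF f(1)] qg(2)[OF f(2)]] by (simp only:)
      then have g: "{x \<in> ?S. g f1 x = g f2 x} \<in> U" by blast
      have sym: "{x \<in> ?S. g f2 x = g f1 x} = {x \<in> ?S. g f1 x = g f2 x}"
        "{\<xi> \<in> ?S'. f2 \<xi> = f1 \<xi>} = {\<xi> \<in> ?S'. f1 \<xi> = f2 \<xi>}" by auto
      show "{\<xi> \<in> ?S'. f1 \<xi> = f2 \<xi>} \<in> U'"
        using G(2)[OF qg(1)[OF f(1)] qg(1)[OF f(2)]]
      proof
        assume "le_ae m (q f1) (q f2)"
        then show ?thesis by (rule agree[OF f g])
      next
        assume "le_ae m (q f2) (q f1)"
        then show ?thesis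
          using agree[OF f(2,1)] g sym by simp
      qed
    qed
  qed
  ultimately show ?thesis by blast
qed

lemma small_ultrapower:
  assumes "a < c"
  shows "\<exists>U. dual_to U (c - 1) \<and> |ultrapower (K a) (K c) U| \<le>o |K (Suc a)|"
  using Suc_leI[OF assms]
proof (induction c rule: dec_induct)
  case base
  show ?case
    using small_ultrapower_base[of a] by simp
next
  case (step c)
  then obtain m where m: "c = Suc m"
    by (cases c) auto
  obtain U where U: "dual_to U m" "|ultrapower (K a) (K c) U| \<le>o |K (Suc a)|"
    using step.IH m by auto
  obtain U' where U': "dual_to U' c"
    "|K a| \<le>o |K c| \<Longrightarrow> |ultrapower (K a) (K (Suc c)) U'| \<le>o |ultrapower (K a) (K c) U|"
    using small_ultrapower_step[OF U(1)] m by auto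
  have "|ultrapower (K a) (K (Suc c)) U'| \<le>o |K (Suc a)|"
    using U'(2)[OF K_mono] step.hyps U(2) ordLeq_transitive by auto
  then show ?case
    using U'(1) by auto
qed

text \<open>
  If \<open>b = c + 1\<close>, every ultrafilter on \<open>\<omega>\<^sub>c\<close> has an ultrapower of \<open>\<omega>\<^sub>a\<close> of size at most \<open>\<omega>\<^sub>b\<close>. Otherwise the
  bound comes from \<open>small_ultrapower\<close>, as \<open>a + 1 \<le> b\<close>. In both cases the product with a regular
  ultrafilter on \<open>\<omega>\<^sub>d\<close>, where \<open>b = d + 1\<close>, enlarges the ultrapower to \<open>2\<^bsup>\<omega>\<^sub>d\<^esup> = \<omega>\<^sub>b\<close>.
\<close>

lemma uniform_ultrapower:
  assumes ab: "a < b" and bc: "b \<le> c + 1"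
  shows "\<exists>U. uniform_ultrafilter_on (K c) U \<and> |ultrapower (K a) (K c) U| =o om b"
proof -
  obtain d where b: "b = Suc d" and ad: "a \<le> d" and dc: "d \<le> c"
    using ab bc by (cases b) auto
  have "\<exists>U. uniform_ultrafilter_on (K c) U \<and> |ultrapower (K a) (K c) U| \<le>o |K b|"
  proof (cases "b \<le> c")
    case True
    then obtain U where U: "dual_to U (c - 1)" "|ultrapower (K a) (K c) U| \<le>o |K (Suc a)|"
      using small_ultrapower[of a c] ab by auto
    have "uniform_ultrafilter_on (K c) U"
      using dual_to_uniform[OF U(1)] True ab by simp
    moreover have "|ultrapower (K a) (K c) U| \<le>o |K b|"
      using ordLeq_transitive[OF U(2) K_mono[of "Suc a" b]] ab by simp
    ultimately show ?thesis by blast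
  next
    case False
    then have b': "b = Suc c" using bc by simp
    obtain U where U: "uniform_ultrafilter_on (K c) U"
      using uniform_ultrafilter_exists[OF infinite_K] by blast
    have "|ultrapower (K a) (K c) U| \<le>o |K c \<rightarrow>\<^sub>E K a|"
      unfolding ultrapower_def by (rule card_of_quotient_ordLeq)
    moreover have "|K c \<rightarrow>\<^sub>E K a| \<le>o |K (Suc c)|"
      using ab b' by (intro PiE_K_ordLeq K_mono) simp
    ultimately show ?thesis
      using U b' ordLeq_transitive by blast
  qed
  then obtain U where U: "uniform_ultrafilter_on (K c) U" "|ultrapower (K a) (K c) U| \<le>o |K b|"
    by blast
  obtain W where W: "uniform_ultrafilter_on (K c) W" "|Pow (K d)| \<le>o |ultrapower (K a) (K c) W|"
    "|ultrapower (K a) (K c) W| \<le>o |K d \<rightarrow>\<^sub>E ultrapower (K a) (K c) U|"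
    using regular_product[OF infinite_K K_mono[OF dc] infinite_K U(1), of a] by blast
  have "|ultrapower (K a) (K c) W| \<le>o |K b|"
    using ordLeq_transitive[OF W(3)] PiE_K_ordLeq[of _ d] U(2) b by blast
  moreover have "|K b| \<le>o |ultrapower (K a) (K c) W|"
    using ordLeq_transitive[OF K_Suc_ordLeq_Pow W(2)] b by simp
  ultimately have "|ultrapower (K a) (K c) W| =o |K b|"
    using ordIso_iff_ordLeq by blast
  then show ?thesis
    using W(1) ordIso_transitive[OF _ card_of_K] by blast
qed

end

theorem theorem68:
  fixes om :: "nat \<Rightarrow> 'a rel"
  assumes "omegas om"
    and "\<forall>n. \<exists>I. normal_ideal (om (Suc n)) I \<and>
           balg_isomorphic (quotient_algebra (Field (om (Suc n))) I)
             (boolean_completion (Col (om n) (om (Suc n))) rev_incl)"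
  shows "\<forall>a b c. a < b \<and> b \<le> c + 1 \<longrightarrow>
           (\<exists>U. uniform_ultrafilter_on (Field (om c)) U \<and>
                |ultrapower (Field (om a)) (Field (om c)) U| =o om b)"
proof -
  interpret omega_sequence om
    by unfold_locales (rule assms(1))
  obtain I where I: "\<And>n. normal_ideal (om (Suc n)) (I n)"
    "\<And>n. balg_isomorphic (quotient_algebra (K (Suc n)) (I n)) (boolean_completion (P n) rev_incl)"
    using assms(2) by metis
  have "\<exists>X. dense_system (K (Suc n)) (I n) (P n) rev_incl X" for n
  proof (rule dense_system_if_balg_isomorphic[OF _ _ _ I(2)])
    show "ideal_on (K (Suc n)) (I n)"
      using I(1) by (simp add: normal_ideal_def)
  qed (auto intro: rev_incl_trans)
  then obtain X where "\<And>n. dense_system (K (Suc n)) (I n) (P n) rev_incl (X n)"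
    by metis
  then interpret collapsing_ideals om I X
    using I(1) by unfold_locales
  show ?thesis
    using uniform_ultrapower by blast
qed

end
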